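(* Let $f$ be a standard operator monotone function and $A\in M_n(\mathbb C)$ self-adjoint. Then $D\mapsto \gamma^f_D(A,A)$ is a convex function on the set of positive definite matrices $D\in M_n(\mathbb C)$.
   Context: A function $f:(0,\infty)\to(0,\infty)$ is standard operator monotone if it is operator monotone, $xf(x^{-1})=f(x)$ for $x>0$ and $f(1)=1$. For positive definite $D$, let $\mathbb L_D X=DX$, $\mathbb R_D X=XD$ on $M_n(\mathbb C)$ and $\mathbb J^f_D=f(\mathbb L_D\mathbb R_D^{-1})\mathbb R_D$ (functional calculus of commuting positive operators on $M_n$ with the Hilbert–Schmidt inner product $\langle B,C\rangle=\mathrm{Tr}\,B^*C$). The monotone metric is $\gamma^f_D(A,B)=\mathrm{Tr}\,A(\mathbb J^f_D)^{-1}(B)$. *)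

theory Defs
  imports Complex_Main "Jordan_Normal_Form.Matrix"
begin

definition cadj :: "complex mat \<Rightarrow> complex mat" where
  "cadj A = Matrix.mat (dim_col A) (dim_row A) (\<lambda>(i,j). cnj (A $$ (j,i)))"

definition mtrace :: "complex mat \<Rightarrow> complex" where
  "mtrace A = (\<Sum>i<dim_row A. A $$ (i,i))"

definition hermitian :: "nat \<Rightarrow> complex mat \<Rightarrow> bool" where
  "hermitian n A \<longleftrightarrow> A \<in> carrier_mat n n \<and> cadj A = A"

definition unitary :: "nat \<Rightarrow> complex mat \<Rightarrow> bool" where
  "unitary n U \<longleftrightarrow> U \<in> carrier_mat n n \<and> cadj U * U = 1\<^sub>m n"

definition qform :: "nat \<Rightarrow> complex mat \<Rightarrow> complex vec \<Rightarrow> complex" where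
  "qform n A v = (\<Sum>i<n. \<Sum>j<n. cnj (v $ i) * A $$ (i,j) * v $ j)"

definition psd :: "nat \<Rightarrow> complex mat \<Rightarrow> bool" where
  "psd n A \<longleftrightarrow> hermitian n A \<and> (\<forall>v \<in> carrier_vec n. Re (qform n A v) \<ge> 0)"

definition posdef :: "nat \<Rightarrow> complex mat \<Rightarrow> bool" where
  "posdef n A \<longleftrightarrow> hermitian n A \<and>
     (\<forall>v \<in> carrier_vec n. v \<noteq> 0\<^sub>v n \<longrightarrow> Re (qform n A v) > 0)"

definition mat_fun :: "(real \<Rightarrow> real) \<Rightarrow> complex mat \<Rightarrow> complex mat" where
  "mat_fun f A = (let n = dim_row A in
     SOME B. \<exists>U d. unitary n U \<and>
        A = U * mat_diag n (\<lambda>i. complex_of_real (d i)) * cadj U \<and>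
        B = U * mat_diag n (\<lambda>i. complex_of_real (f (d i))) * cadj U)"

definition operator_monotone :: "(real \<Rightarrow> real) \<Rightarrow> bool" where
  "operator_monotone f \<longleftrightarrow>
     (\<forall>n A B. posdef n A \<longrightarrow> posdef n B \<longrightarrow> psd n (B - A) \<longrightarrow>
        psd n (mat_fun f B - mat_fun f A))"

definition standard_operator_monotone :: "(real \<Rightarrow> real) \<Rightarrow> bool" where
  "standard_operator_monotone f \<longleftrightarrow> operator_monotone f \<and>
     (\<forall>x>0. f x > 0) \<and> (\<forall>x>0. x * f (1 / x) = f x) \<and> f 1 = 1"

(* J^f_D = f(L_D R_D^{-1}) R_D, by joint functional calculus of the commuting
   operators L_D, R_D: if D = U diag(d) U^*, then L_D, R_D are simultaneously
   diagonal in the basis X \<mapsto> U X U^* with eigenvalues d_i, d_j on the (i,j) unit. *)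
definition Jf :: "(real \<Rightarrow> real) \<Rightarrow> nat \<Rightarrow> complex mat \<Rightarrow> complex mat \<Rightarrow> complex mat" where
  "Jf f n D = (SOME J. \<exists>U d. unitary n U \<and>
        D = U * mat_diag n (\<lambda>i. complex_of_real (d i)) * cadj U \<and>
        J = (\<lambda>X. U * Matrix.mat n n (\<lambda>(i,j).
               complex_of_real (f (d i / d j) * d j) * (cadj U * X * U) $$ (i,j)) * cadj U))"

definition gamma_f :: "(real \<Rightarrow> real) \<Rightarrow> nat \<Rightarrow> complex mat \<Rightarrow> complex mat \<Rightarrow> complex mat \<Rightarrow> complex" where
  "gamma_f f n D A B = mtrace (A * the_inv_into (carrier_mat n n) (Jf f n D) B)"

end

theory Submission
  imports Defs "Jordan_Normal_Form.Schur_Decomposition" "Jordan_Normal_Form.Spectral_Radius"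
begin

text \<open>In an eigenbasis of \<open>D\<close> the metric is \<open>\<Sum> |A\<^sub>i\<^sub>j|\<^sup>2 / (f (d\<^sub>i / d\<^sub>j) d\<^sub>j)\<close>, and
  \<open>\<langle>A, J\<^sup>-\<^sup>1 A\<rangle> = sup\<^sub>X (2 Re \<langle>X, A\<rangle> - \<langle>X, J X\<rangle>)\<close>, so it suffices that \<open>D \<mapsto> \<langle>X, J X\<rangle>\<close> is
  concave. As \<open>J\<close> is the perspective \<open>f (L R\<^sup>-\<^sup>1) R\<close> of commuting operators (Effros), this follows from
  the Hansen--Pedersen inequality \<open>V* f(T) V \<le> f(V* T V)\<close> for isometries \<open>V\<close>, which is deduced from
  operator monotonicity applied to one pair of matrices.\<close>

section \<open>Unitary matrices and the spectral theorem\<close>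

text \<open>Both functional calculi are fixed only by a choice among diagonalisations. For
  \<open>mat_fun\<close> the choice is neutralised through eigenvectors: \<open>f(B)\<close> is
  evaluated only on vectors whose eigenvalue under \<open>B\<close> is known. For \<open>Jf\<close>
  the whole argument runs in whichever eigenbases were chosen. Operators on \<open>M_n\<close> are
  therefore never turned into large matrices by hand: they are multipliers on index pairs, and the
  Jensen inequality is stated in coordinates, for families over arbitrary finite index sets. It is
  there that operator monotonicity in every dimension enters: two \<open>n\<close> by
  \<open>n\<close> matrices lead to a direct sum of two copies of \<open>M_n\<close>, hence to
  matrices of size \<open>2 n^2\<close>. Strict domination of a matrix by a block-diagonal one costs
  a factor \<open>1 + e\<close>; removing it calls for control of \<open>f\<close> near a point,
  which comes from the symmetry of \<open>f\<close> and not from a limit theorem. The supremum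
  formula is used asymmetrically: equality at the mixture, only the easy bound at the two
  endpoints.\<close>

lemma cadj_carrier [simp]: "A \<in> carrier_mat m n \<Longrightarrow> cadj A \<in> carrier_mat n m"
  unfolding cadj_def by (intro carrier_matI) auto

lemma cadj_dim [simp]: "dim_row (cadj A) = dim_col A" "dim_col (cadj A) = dim_row A"
  by (simp_all add: cadj_def)

lemma cadj_index: "A \<in> carrier_mat m n \<Longrightarrow> i < n \<Longrightarrow> j < m \<Longrightarrow> cadj A $$ (i, j) = cnj (A $$ (j, i))"
  by (simp add: cadj_def)

lemma cadj_cadj [simp]: "cadj (cadj A) = A"
  by (rule eq_matI) (auto simp: cadj_def)

lemma mult_mat_index:
  assumes "A \<in> carrier_mat m k" "B \<in> carrier_mat k n" "i < m" "j < n"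
  shows "(A * B) $$ (i, j) = (\<Sum>l<k. A $$ (i, l) * B $$ (l, j))"
  using assms by (auto simp: scalar_prod_def atLeast0LessThan intro!: sum.cong)

lemma mult_mat_vec_index:
  assumes "A \<in> carrier_mat m k" "v \<in> carrier_vec k" "i < m"
  shows "(A *\<^sub>v v) $ i = (\<Sum>l<k. A $$ (i, l) * v $ l)"
  using assms by (auto simp: scalar_prod_def atLeast0LessThan intro!: sum.cong)

lemma sq_mult_carrier [simp]: "A \<in> carrier_mat n n \<Longrightarrow> B \<in> carrier_mat n n \<Longrightarrow> A * B \<in> carrier_mat n n"
  by simp

lemma sq_mult_assoc:
  assumes "A \<in> carrier_mat n n" "B \<in> carrier_mat n n" "C \<in> carrier_mat n n"
  shows "A * B * C = A * (B * C)"
  using assms by simp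

lemma cadj_mult:
  assumes "A \<in> carrier_mat m k" "B \<in> carrier_mat k n"
  shows "cadj (A * B) = cadj B * cadj A"
proof (rule eq_matI)
  fix i j assume "i < dim_row (cadj B * cadj A)" "j < dim_col (cadj B * cadj A)"
  then have ij: "i < n" "j < m" using assms by (auto simp: cadj_def)
  show "cadj (A * B) $$ (i, j) = (cadj B * cadj A) $$ (i, j)"
    using assms ij
    by (subst cadj_index[of _ m n], simp_all add: mult_mat_index[of _ n k _ m] mult_mat_index[of _ m k _ n]
        cadj_index mult.commute del: index_mult_mat)
qed (use assms in \<open>auto simp: cadj_def\<close>)

lemma cadj_mat_diag_real [simp]:
  "cadj (mat_diag n (\<lambda>i. complex_of_real (d i))) = mat_diag n (\<lambda>i. complex_of_real (d i))"
  by (rule eq_matI) (auto simp: cadj_def mat_diag_def)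

lemma unitary_carrier: "unitary n U \<Longrightarrow> U \<in> carrier_mat n n"
  by (simp add: unitary_def)

lemma unitary_left: "unitary n U \<Longrightarrow> cadj U * U = 1\<^sub>m n"
  by (simp add: unitary_def)

lemma unitary_right: "unitary n U \<Longrightarrow> U * cadj U = 1\<^sub>m n"
  using mat_mult_left_right_inverse[of "cadj U" n U] by (simp add: unitary_def)

lemma unitary_cadj: "unitary n U \<Longrightarrow> unitary n (cadj U)"
  using unitary_right by (simp add: unitary_def)

lemma unitary_cancel:
  assumes "unitary n U" "X \<in> carrier_mat n m"
  shows "cadj U * (U * X) = X" "U * (cadj U * X) = X"
  using assms unitary_right[of n U]
  by (simp_all add: unitary_def assoc_mult_mat[of _ n n _ n _ m, symmetric] del: assoc_mult_mat)

lemma unitary_cancel_vec: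
  assumes "unitary n U" "x \<in> carrier_vec n"
  shows "cadj U *\<^sub>v (U *\<^sub>v x) = x" "U *\<^sub>v (cadj U *\<^sub>v x) = x"
  using assms unitary_right[of n U]
  by (simp_all add: unitary_def assoc_mult_mat_vec[of _ n n _ n, symmetric] del: assoc_mult_mat_vec)

lemma unitary_mult:
  assumes "unitary n U" "unitary n V"
  shows "unitary n (U * V)"
  using assms unitary_cancel[OF assms(1), of V n]
  by (simp add: unitary_def cadj_mult[of _ n n _ n] sq_mult_assoc[of _ n])

lemma unitary_col_sum:
  assumes "unitary n U" "i < n" "j < n"
  shows "(\<Sum>k<n. cnj (U $$ (k, i)) * U $$ (k, j)) = (if i = j then 1 else 0)"
proof -
  have "(\<Sum>k<n. cnj (U $$ (k, i)) * U $$ (k, j)) = (cadj U * U) $$ (i, j)"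
    using assms unitary_carrier[OF assms(1)]
    by (simp add: mult_mat_index[of _ n n _ n] cadj_index del: index_mult_mat)
  then show ?thesis using assms by (simp add: unitary_left)
qed

lemma conj_unitary_eq_iff:
  assumes U: "unitary n U" and A: "A \<in> carrier_mat n n" and B: "B \<in> carrier_mat n n"
  shows "A = U * B * cadj U \<longleftrightarrow> cadj U * A * U = B"
proof -
  have c: "U \<in> carrier_mat n n" "cadj U \<in> carrier_mat n n" using unitary_carrier[OF U] by auto
  show ?thesis
  proof
    assume "A = U * B * cadj U"
    then show "cadj U * A * U = B"
      using c B unitary_cancel[OF U] unitary_left[OF U]
      by (simp add: sq_mult_assoc[of _ n])
  next
    assume "cadj U * A * U = B"
    then have "U * B * cadj U = U * (cadj U * A * U) * cadj U" by simp
    also have "\<dots> = A"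
      using c A unitary_cancel[OF U] unitary_right[OF U]
      by (simp add: sq_mult_assoc[of _ n])
    finally show "A = U * B * cadj U" by simp
  qed
qed

lemma hermitian_conj:
  assumes "hermitian n A" "U \<in> carrier_mat n n"
  shows "hermitian n (cadj U * A * U)"
  using assms by (simp add: hermitian_def cadj_mult[of _ n n _ n] sq_mult_assoc[of _ n])

lemma hermitian_index:
  assumes "hermitian n A" "i < n" "j < n"
  shows "A $$ (j, i) = cnj (A $$ (i, j))"
  using assms cadj_index[of A n n j i] by (simp add: hermitian_def)

text \<open>Provides the change of basis that splits off an eigenvector. Gram-Schmidt on a basis
  completing \<open>v\<close> gives orthogonal vectors that are not yet of norm one; the
  normalisation is the source of the scalar \<open>c\<close>.\<close>

lemma exists_unitary_col:
  fixes v :: "complex vec"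
  assumes v: "v \<in> carrier_vec n" and v0: "v \<noteq> 0\<^sub>v n" and n: "0 < n"
  shows "\<exists>U c. unitary n U \<and> col U 0 = c \<cdot>\<^sub>v v \<and> c \<noteq> 0"
proof -
  interpret cof_vec_space n "TYPE(complex)" .
  define ws where "ws = gram_schmidt n (basis_completion v)"
  note bc = basis_completion[OF v v0]
  have ws: "set ws \<subseteq> carrier_vec n" "corthogonal ws" "length ws = n"
    using gram_schmidt_result[OF bc(2,4,5) ws_def] bc(6) by auto
  have "ws ! 0 = v"
  proof -
    obtain vs where "basis_completion v = v # vs"
      using bc(6,7) n by (cases "basis_completion v") auto
    then have "hd ws = v" using gram_schmidt_hd[OF v, of vs] by (simp add: ws_def)
    then show ?thesis using ws(3) n by (cases ws) auto
  qed
  define q where "q j = (\<Sum>k<n. (cmod (ws ! j $ k))\<^sup>2)" for j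
  have wsc: "ws ! j \<in> carrier_vec n" if "j < n" for j using ws that by auto
  have ip: "ws ! i \<bullet>c ws ! j = (\<Sum>k<n. ws ! i $ k * cnj (ws ! j $ k))" if "i < n" "j < n" for i j
    using wsc[OF that(1)] wsc[OF that(2)]
    by (auto simp: scalar_prod_def atLeast0LessThan intro!: sum.cong)
  have qi: "ws ! j \<bullet>c ws ! j = complex_of_real (q j)" if "j < n" for j
    by (simp add: ip that q_def complex_norm_square[symmetric])
  have qpos: "q j > 0" if "j < n" for j
  proof -
    \<comment> \<open>\<open>corthogonal\<close> also says that no vector of the list is orthogonal
      to itself.\<close>
    have "q j \<noteq> 0" using ws(2) that ws(3) qi[OF that] unfolding corthogonal_def by auto
    moreover have "q j \<ge> 0" by (simp add: q_def sum_nonneg)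
    ultimately show ?thesis by simp
  qed
  define U where "U = mat n n (\<lambda>(k, j). ws ! j $ k / complex_of_real (sqrt (q j)))"
  have Uc: "U \<in> carrier_mat n n" by (simp add: U_def)
  have "cadj U * U = 1\<^sub>m n"
  proof (rule eq_matI)
    fix i j assume "i < dim_row (1\<^sub>m n :: complex mat)" "j < dim_col (1\<^sub>m n :: complex mat)"
    then have ij: "i < n" "j < n" by auto
    have "(cadj U * U) $$ (i, j) = (\<Sum>k<n. cnj (U $$ (k, i)) * U $$ (k, j))"
      using ij Uc by (simp add: mult_mat_index[of _ n n _ n] cadj_index del: index_mult_mat)
    also have "\<dots> = (\<Sum>k<n. ws ! j $ k * cnj (ws ! i $ k)) / (of_real (sqrt (q i)) * of_real (sqrt (q j)))"
      unfolding sum_divide_distrib using ij by (auto simp: U_def intro!: sum.cong)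
    also have "\<dots> = (ws ! j \<bullet>c ws ! i) / (of_real (sqrt (q i)) * of_real (sqrt (q j)))"
      using ij by (simp add: ip)
    also have "\<dots> = (if i = j then 1 else 0)"
    proof (cases "i = j")
      case True
      have "complex_of_real (sqrt (q j)) * complex_of_real (sqrt (q j)) = complex_of_real (q j)"
        using qpos[OF ij(2)] by (simp flip: of_real_mult)
      then show ?thesis using True qi[OF ij(2)] qpos[OF ij(2)] by simp
    next
      case False
      then show ?thesis using ws(2,3) ij unfolding corthogonal_def by auto
    qed
    finally show "(cadj U * U) $$ (i, j) = 1\<^sub>m n $$ (i, j)" using ij by simp
  qed (use Uc in auto)
  then have "unitary n U" using Uc by (simp add: unitary_def)
  moreover have "col U 0 = (1 / complex_of_real (sqrt (q 0))) \<cdot>\<^sub>v v"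
    using v n \<open>ws ! 0 = v\<close> by (intro eq_vecI) (auto simp: U_def)
  moreover have "1 / complex_of_real (sqrt (q 0)) \<noteq> 0" using qpos[OF n] by simp
  ultimately show ?thesis by blast
qed

lemma mult_block_diag_mat:
  fixes A1 A2 B1 B2 :: "'a::semiring_0 mat"
  assumes "A1 \<in> carrier_mat p p" "A2 \<in> carrier_mat p p" "B1 \<in> carrier_mat q q" "B2 \<in> carrier_mat q q"
  shows "four_block_mat A1 (0\<^sub>m p q) (0\<^sub>m q p) B1 * four_block_mat A2 (0\<^sub>m p q) (0\<^sub>m q p) B2
    = four_block_mat (A1 * A2) (0\<^sub>m p q) (0\<^sub>m q p) (B1 * B2)"
  using assms
  by (simp add: mult_four_block_mat[of _ p p _ q _ q _ _ p _ q]
      left_mult_zero_mat[of _ q] left_mult_zero_mat[of _ p]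
      right_mult_zero_mat[of _ q q] right_mult_zero_mat[of _ p p]
      left_add_zero_mat[of _ p p] right_add_zero_mat[of _ p p]
      left_add_zero_mat[of _ q q] right_add_zero_mat[of _ q q])

text \<open>Deflation: with an eigenvector as first column of \<open>U\<close>, the first column of
  \<open>U* A U\<close> vanishes below the corner. Hermitian symmetry then clears the first row and
  makes the eigenvalue real, and the induction hypothesis diagonalises the remaining block.\<close>

theorem hermitian_spectral:
  assumes "hermitian n A"
  shows "\<exists>U d. unitary n U \<and> A = U * mat_diag n (\<lambda>i. complex_of_real (d i)) * cadj U"
  using assms
proof (induction n arbitrary: A)
  case 0
  then have "A = 1\<^sub>m 0 * mat_diag 0 (\<lambda>i. complex_of_real 0) * cadj (1\<^sub>m 0)"
    by (intro eq_matI) (auto simp: hermitian_def cadj_def mat_diag_def)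
  moreover have "unitary 0 (1\<^sub>m 0)" unfolding unitary_def
    by (auto intro!: eq_matI simp: cadj_def)
  ultimately show ?case by (intro exI[of _ "1\<^sub>m 0"] exI[of _ "\<lambda>_. 0"]) simp
next
  case (Suc n)
  let ?N = "Suc n"
  have A: "A \<in> carrier_mat ?N ?N" using Suc.prems by (simp add: hermitian_def)
  obtain e v where v: "v \<in> carrier_vec ?N" "v \<noteq> 0\<^sub>v ?N" "A *\<^sub>v v = e \<cdot>\<^sub>v v"
    using spectrum_non_empty[OF A] A unfolding spectrum_def eigenvalue_def eigenvector_def by auto
  obtain U c where U: "unitary ?N U" and c: "col U 0 = c \<cdot>\<^sub>v v"
    using exists_unitary_col[OF v(1,2)] by auto
  note Uc = unitary_carrier[OF U]
  have U0: "col U 0 \<in> carrier_vec ?N" using v by (simp add: c)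
  define B where "B = cadj U * A * U"
  have hB: "hermitian ?N B" using hermitian_conj[OF Suc.prems Uc] by (simp add: B_def)
  then have Bc: "B \<in> carrier_mat ?N ?N" by (simp add: hermitian_def)
  have B0: "B $$ (i, 0) = (if i = 0 then e else 0)" if "i < ?N" for i
  proof -
    have "col B 0 = cadj U *\<^sub>v (A *\<^sub>v col U 0)"
      using A Uc by (simp add: B_def sq_mult_assoc[of _ ?N] col_mult2[of _ ?N ?N _ ?N]
          del: col_mult)
    also have "A *\<^sub>v col U 0 = c \<cdot>\<^sub>v (e \<cdot>\<^sub>v v)"
      using A v by (simp add: c mult_mat_vec[of _ ?N ?N])
    also have "\<dots> = e \<cdot>\<^sub>v col U 0"
      by (simp add: c smult_smult_assoc mult.commute)
    also have "cadj U *\<^sub>v (e \<cdot>\<^sub>v col U 0) = e \<cdot>\<^sub>v (col (cadj U * U) 0)"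
      using Uc U0 by (simp add: mult_mat_vec[of _ ?N ?N] col_mult2[of _ ?N ?N _ ?N])
    also have "\<dots> = e \<cdot>\<^sub>v col (1\<^sub>m ?N) 0" using unitary_left[OF U] by simp
    finally have "col B 0 $ i = (e \<cdot>\<^sub>v col (1\<^sub>m ?N) 0) $ i" by simp
    then show ?thesis using Bc that by (simp split: if_splits)
  qed
  have "cnj e = e" using hermitian_index[OF hB, of 0 0] B0[of 0] by simp
  then have er: "e = complex_of_real (Re e)" by (simp add: complex_eq_iff)
  have B0': "B $$ (0, i) = (if i = 0 then e else 0)" if "i < ?N" for i
    using hermitian_index[OF hB that, of 0] B0[OF that] \<open>cnj e = e\<close> by auto
  define C where "C = mat n n (\<lambda>(i, j). B $$ (Suc i, Suc j))"
  have "hermitian n C"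
    unfolding hermitian_def
    by (auto intro!: eq_matI simp: C_def cadj_def hermitian_index[OF hB, symmetric])
  from Suc.IH[OF this] obtain V d where V: "unitary n V"
    and Cd: "C = V * mat_diag n (\<lambda>i. complex_of_real (d i)) * cadj V" by blast
  note Vc = unitary_carrier[OF V]
  let ?D = "mat_diag n (\<lambda>i. complex_of_real (d i))"
  define W where "W = four_block_mat (1\<^sub>m 1) (0\<^sub>m 1 n) (0\<^sub>m n 1) V"
  \<comment> \<open>The split-off eigenvalue goes in front and the eigenvalues of \<open>C\<close>
    move up by one index.\<close>
  define d' where "d' = case_nat (Re e) d"
  have Wc: "W \<in> carrier_mat ?N ?N" using Vc by (simp add: W_def four_block_carrier_mat[of _ 1 1 _ n n, simplified])
  have cW: "cadj W = four_block_mat (1\<^sub>m 1) (0\<^sub>m 1 n) (0\<^sub>m n 1) (cadj V)"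
    using Vc by (intro eq_matI) (auto simp: W_def cadj_def)
  have W: "unitary ?N W"
    unfolding unitary_def
  proof
    have "cadj W * W = four_block_mat (1\<^sub>m 1) (0\<^sub>m 1 n) (0\<^sub>m n 1) (1\<^sub>m n)"
      unfolding cW unfolding W_def using Vc unitary_left[OF V]
      by (simp add: mult_block_diag_mat)
    then show "cadj W * W = 1\<^sub>m ?N" by simp
  qed (fact Wc)
  have D': "mat_diag ?N (\<lambda>i. complex_of_real (d' i))
      = four_block_mat (mat 1 1 (\<lambda>_. e)) (0\<^sub>m 1 n) (0\<^sub>m n 1) ?D"
    by (intro eq_matI) (auto simp: mat_diag_def d'_def er[symmetric] split: nat.splits)
  have "W * mat_diag ?N (\<lambda>i. complex_of_real (d' i)) * cadj W
      = four_block_mat (mat 1 1 (\<lambda>_. e)) (0\<^sub>m 1 n) (0\<^sub>m n 1) C"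
    unfolding D' cW unfolding W_def using Vc
    by (simp add: mult_block_diag_mat Cd sq_mult_assoc[of _ n])
  also have "\<dots> = B"
  proof (rule eq_matI)
    fix i j assume "i < dim_row B" "j < dim_col B"
    then have "i < ?N" "j < ?N" using Bc by auto
    then show "four_block_mat (mat 1 1 (\<lambda>_. e)) (0\<^sub>m 1 n) (0\<^sub>m n 1) C $$ (i, j) = B $$ (i, j)"
      using B0[of i] B0'[of j] by (cases i; cases j) (auto simp: C_def)
  qed (use Bc in \<open>auto simp: C_def\<close>)
  finally have "B = W * mat_diag ?N (\<lambda>i. complex_of_real (d' i)) * cadj W" by simp
  then have "A = U * (W * mat_diag ?N (\<lambda>i. complex_of_real (d' i)) * cadj W) * cadj U"
    using conj_unitary_eq_iff[OF U A Bc] by (simp add: B_def)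
  also have "\<dots> = (U * W) * mat_diag ?N (\<lambda>i. complex_of_real (d' i)) * cadj (U * W)"
    using Uc Wc by (simp add: cadj_mult[of _ ?N ?N _ ?N] sq_mult_assoc[of _ ?N])
  finally show ?case using unitary_mult[OF U W] by blast
qed

section \<open>Functional calculus\<close>

lemma mat_diag_dims [simp]: "dim_row (mat_diag n d) = n" "dim_col (mat_diag n d) = n"
  by (simp_all add: mat_diag_def)

section \<open>Quadratic forms and hermitian matrices\<close>

lemma qform_eq:
  assumes "A \<in> carrier_mat n n" "v \<in> carrier_vec n"
  shows "qform n A v = (\<Sum>i<n. cnj (v $ i) * (A *\<^sub>v v) $ i)"
  unfolding qform_def using assms
  by (auto simp: mult_mat_vec_index[of _ n n] sum_distrib_left mult.assoc simp del: index_mult_mat_vec intro!: sum.cong)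

lemma mat_diag_mult_vec_index:
  assumes "v \<in> carrier_vec n" "i < n"
  shows "(mat_diag n d *\<^sub>v v) $ i = d i * v $ i"
proof -
  have "(mat_diag n d *\<^sub>v v) $ i = (\<Sum>l<n. (if i = l then d l else 0) * v $ l)"
    using assms by (subst mult_mat_vec_index[of _ n n]) (auto simp: mat_diag_def)
  also have "\<dots> = (\<Sum>l<n. if i = l then d l * v $ l else 0)"
    by (rule sum.cong) auto
  finally show ?thesis using assms by simp
qed

lemma qform_diff:
  assumes "A \<in> carrier_mat n n" "B \<in> carrier_mat n n"
  shows "qform n (B - A) v = qform n B v - qform n A v"
  unfolding qform_def using assms by (simp add: sum_subtractf algebra_simps)

lemma hermitian_mat_diag_real: "hermitian n (mat_diag n (\<lambda>i. complex_of_real (d i)))"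
  by (simp add: hermitian_def)

lemma hermitianI:
  assumes "A \<in> carrier_mat n n" "\<And>i j. i < n \<Longrightarrow> j < n \<Longrightarrow> A $$ (j, i) = cnj (A $$ (i, j))"
  shows "hermitian n A"
  unfolding hermitian_def
proof
  show "cadj A = A"
  proof (rule eq_matI)
    fix i j assume "i < dim_row A" "j < dim_col A"
    then have "i < n" "j < n" using assms(1) by auto
    then show "cadj A $$ (i, j) = A $$ (i, j)"
      by (simp only: cadj_index[OF assms(1)] assms(2)[of j i])
  qed (use assms(1) in auto)
qed (fact assms(1))

lemma hermitian_diff:
  assumes "hermitian n A" "hermitian n B"
  shows "hermitian n (A - B)"
proof (rule hermitianI)
  have c: "A \<in> carrier_mat n n" "B \<in> carrier_mat n n" using assms by (auto simp: hermitian_def)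
  then show "A - B \<in> carrier_mat n n" by auto
  fix i j assume ij: "i < n" "j < n"
  then show "(A - B) $$ (j, i) = cnj ((A - B) $$ (i, j))"
    using c hermitian_index[OF assms(1) ij] hermitian_index[OF assms(2) ij] by simp
qed

lemma qform_mat_diag_real:
  assumes "v \<in> carrier_vec n"
  shows "qform n (mat_diag n (\<lambda>i. complex_of_real (d i))) v
    = complex_of_real (\<Sum>i<n. d i * (cmod (v $ i))\<^sup>2)"
  using assms
  by (simp add: qform_eq mat_diag_mult_vec_index complex_norm_square ac_simps del: of_real_power index_mult_mat_vec)

lemma posdef_mat_diag:
  assumes "\<And>i. i < n \<Longrightarrow> d i > 0"
  shows "posdef n (mat_diag n (\<lambda>i. complex_of_real (d i)))"
  unfolding posdef_def
proof (intro conjI ballI impI)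
  fix v :: "complex vec" assume v: "v \<in> carrier_vec n" "v \<noteq> 0\<^sub>v n"
  then obtain k where k: "k < n" "v $ k \<noteq> 0"
    by (metis carrier_vecD eq_vecI index_zero_vec)
  have "0 < d k * (cmod (v $ k))\<^sup>2" using k assms by simp
  also have "\<dots> \<le> (\<Sum>i<n. d i * (cmod (v $ i))\<^sup>2)"
    using k assms by (intro member_le_sum) (auto intro!: mult_nonneg_nonneg intro: less_imp_le)
  finally show "0 < Re (qform n (mat_diag n (\<lambda>i. complex_of_real (d i))) v)"
    by (simp add: qform_mat_diag_real[OF v(1)])
qed (rule hermitian_mat_diag_real)

text \<open>The spectral theorem makes the choice in \<open>mat_fun\<close> meaningful. The
  decomposition obtained is the one behind the choice: it may vary with \<open>f\<close> and cannot
  be prescribed.\<close>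

lemma mat_fun_decomp:
  assumes "hermitian n A"
  obtains U d where "unitary n U" "A = U * mat_diag n (\<lambda>i. complex_of_real (d i)) * cadj U"
    "mat_fun f A = U * mat_diag n (\<lambda>i. complex_of_real (f (d i))) * cadj U"
proof -
  have n: "dim_row A = n" using assms by (auto simp: hermitian_def)
  let ?P = "\<lambda>B. \<exists>U d. unitary n U \<and>
        A = U * mat_diag n (\<lambda>i. complex_of_real (d i)) * cadj U \<and>
        B = U * mat_diag n (\<lambda>i. complex_of_real (f (d i))) * cadj U"
  have "\<exists>B. ?P B" using hermitian_spectral[OF assms] by blast
  then have "?P (SOME B. ?P B)" by (rule someI_ex)
  moreover have "mat_fun f A = (SOME B. ?P B)" by (simp only: mat_fun_def Let_def n)
  ultimately have "?P (mat_fun f A)" by simp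
  then show thesis using that by blast
qed

lemma mat_fun_carrier: "hermitian n A \<Longrightarrow> mat_fun f A \<in> carrier_mat n n"
  by (erule mat_fun_decomp[where f = f]) (use unitary_carrier in auto)

text \<open>Frees \<open>mat_fun\<close> from the chosen diagonalisation: whatever \<open>U\<close>
  and \<open>d\<close> are, the coordinates of \<open>w\<close> in the basis \<open>U\<close> are
  supported where \<open>d i = s\<close>, and there \<open>f(d)\<close> is the scalar
  \<open>f s\<close>.\<close>

lemma mat_fun_eigenvector:
  assumes A: "hermitian n A" and w: "w \<in> carrier_vec n"
    and eig: "A *\<^sub>v w = complex_of_real s \<cdot>\<^sub>v w"
  shows "mat_fun f A *\<^sub>v w = complex_of_real (f s) \<cdot>\<^sub>v w"
proof -
  obtain U d where U: "unitary n U"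
    and Ad: "A = U * mat_diag n (\<lambda>i. complex_of_real (d i)) * cadj U"
    and fA: "mat_fun f A = U * mat_diag n (\<lambda>i. complex_of_real (f (d i))) * cadj U"
    using mat_fun_decomp[OF A] by blast
  note Uc = unitary_carrier[OF U]
  define y where "y = cadj U *\<^sub>v w"
  have y: "y \<in> carrier_vec n" using Uc w by (simp add: y_def mult_mat_vec_carrier[of _ n n])
  have w_eq: "w = U *\<^sub>v y" using unitary_cancel_vec[OF U w] by (simp add: y_def)
  have conj_apply: "(U * mat_diag n g * cadj U) *\<^sub>v w = U *\<^sub>v (mat_diag n g *\<^sub>v y)" for g
    using Uc w by (simp add: y_def assoc_mult_mat_vec[of _ n n _ n] mult_mat_vec_carrier[of _ n n])
  have "U *\<^sub>v (mat_diag n (\<lambda>i. complex_of_real (d i)) *\<^sub>v y) = U *\<^sub>v (complex_of_real s \<cdot>\<^sub>v y)"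
    using eig conj_apply y Uc by (simp add: Ad w_eq[symmetric] mult_mat_vec[of _ n n])
  then have "cadj U *\<^sub>v (U *\<^sub>v (mat_diag n (\<lambda>i. complex_of_real (d i)) *\<^sub>v y))
      = cadj U *\<^sub>v (U *\<^sub>v (complex_of_real s \<cdot>\<^sub>v y))" by (rule arg_cong)
  then have "mat_diag n (\<lambda>i. complex_of_real (d i)) *\<^sub>v y = complex_of_real s \<cdot>\<^sub>v y"
    using y by (simp only: unitary_cancel_vec(1)[OF U] mult_mat_vec_carrier[OF mat_diag_dim] smult_carrier_vec)
  then have "d i = s \<or> y $ i = 0" if "i < n" for i
    using that y mat_diag_mult_vec_index[OF y that, of "\<lambda>i. complex_of_real (d i)"] by auto
  then have "mat_diag n (\<lambda>i. complex_of_real (f (d i))) *\<^sub>v y = complex_of_real (f s) \<cdot>\<^sub>v y"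
    using y by (intro eq_vecI) (force simp: mat_diag_mult_vec_index simp del: index_mult_mat_vec)+
  then show ?thesis
    using y Uc by (simp add: fA conj_apply mult_mat_vec[of _ n n] w_eq[symmetric])
qed

text \<open>The choice may have used another \<open>U\<close> than the identity, but unit vectors
  are eigenvectors, which determines every column.\<close>

lemma mat_fun_mat_diag:
  "mat_fun f (mat_diag n (\<lambda>i. complex_of_real (d i))) = mat_diag n (\<lambda>i. complex_of_real (f (d i)))"
    (is "?F = ?D")
proof (rule eq_matI)
  fix i j assume "i < dim_row ?D" "j < dim_col ?D"
  then have ij: "i < n" "j < n" by (auto simp: mat_diag_def)
  have Fc: "?F \<in> carrier_mat n n" by (rule mat_fun_carrier[OF hermitian_mat_diag_real])
  have "mat_diag n (\<lambda>i. complex_of_real (d i)) *\<^sub>v unit_vec n j = complex_of_real (d j) \<cdot>\<^sub>v unit_vec n j"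
    using ij by (intro eq_vecI) (auto simp: mat_diag_mult_vec_index simp del: index_mult_mat_vec)
  then have "?F *\<^sub>v unit_vec n j = complex_of_real (f (d j)) \<cdot>\<^sub>v unit_vec n j"
    by (intro mat_fun_eigenvector[OF hermitian_mat_diag_real]) auto
  moreover have "(?F *\<^sub>v unit_vec n j) $ i = ?F $$ (i, j)"
    using Fc ij by simp
  ultimately have "?F $$ (i, j) = (complex_of_real (f (d j)) \<cdot>\<^sub>v unit_vec n j) $ i" by simp
  then show "?F $$ (i, j) = ?D $$ (i, j)" using ij by (auto simp: mat_diag_def)
qed (use mat_fun_carrier[OF hermitian_mat_diag_real, of f n d] in \<open>auto simp: mat_diag_def\<close>)

text \<open>Positive scalars are positive definite matrices of size one.\<close>

lemma operator_monotone_mono: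
  assumes f: "operator_monotone f" and x: "0 < x" "x \<le> y"
  shows "f x \<le> f y"
proof -
  let ?D = "\<lambda>c::real. mat_diag (Suc 0) (\<lambda>_. complex_of_real c)"
  have v: "vec (Suc 0) (\<lambda>_. 1) \<in> carrier_vec (Suc 0)" by simp
  have "psd (Suc 0) (?D y - ?D x)"
    unfolding psd_def
  proof (intro conjI ballI)
    fix v :: "complex vec" assume "v \<in> carrier_vec (Suc 0)"
    then show "0 \<le> Re (qform (Suc 0) (?D y - ?D x) v)"
      using x by (simp add: qform_diff qform_mat_diag_real mult_right_mono)
  qed (intro hermitian_diff hermitian_mat_diag_real)
  moreover have "posdef (Suc 0) (?D x)" "posdef (Suc 0) (?D y)"
    using x posdef_mat_diag[of "Suc 0" "\<lambda>_. x"] posdef_mat_diag[of "Suc 0" "\<lambda>_. y"] by auto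
  ultimately have "psd (Suc 0) (mat_fun f (?D y) - mat_fun f (?D x))"
    using f unfolding operator_monotone_def by blast
  then have "0 \<le> Re (qform (Suc 0) (?D (f y) - ?D (f x)) (vec (Suc 0) (\<lambda>_. 1)))"
    using v unfolding psd_def mat_fun_mat_diag by blast
  then show ?thesis by (simp add: qform_diff qform_mat_diag_real[OF v])
qed

text \<open>By the symmetry \<open>f x = x * f (1 / x)\<close>, the function \<open>f x / x\<close> is antitone; this
  replaces a separate proof that \<open>f\<close> is continuous.\<close>

lemma standard_operator_monotone_scale:
  assumes f: "standard_operator_monotone f" and s: "0 < s" and e: "0 < (e::real)"
  shows "f ((1 + e) * s) \<le> (1 + e) * f s"
proof -
  have om: "operator_monotone f" using f by (rule standard_operator_monotone_def[THEN iffD1, THEN conjunct1])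
  have sym: "x * f (1 / x) = f x" if "x > 0" for x
    using f that unfolding standard_operator_monotone_def by blast
  have "1 / ((1 + e) * s) \<le> 1 / s" using s e by (intro divide_left_mono) (auto simp: algebra_simps intro!: add_pos_pos)
  then have "f (1 / ((1 + e) * s)) \<le> f (1 / s)"
    using s e by (intro operator_monotone_mono[OF om]) simp_all
  then have "(1 + e) * s * f (1 / ((1 + e) * s)) \<le> (1 + e) * s * f (1 / s)"
    using s e by (intro mult_left_mono) auto
  also have "\<dots> = (1 + e) * f s" using sym[OF s] by (metis mult.assoc)
  also have "(1 + e) * s * f (1 / ((1 + e) * s)) = f ((1 + e) * s)"
    using s e by (intro sym) simp
  finally show ?thesis .
qed

section \<open>The operator Jensen inequality\<close>

text \<open>Young's inequality for the cross term, weighted so that the factor at \<open>u\<close>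
  stays near 1 and the cost falls on \<open>y\<close>. Below, \<open>u\<close> is a projection onto
  the range of the isometry and \<open>y\<close> the remainder.\<close>

lemma cmod_add_square_le:
  assumes "0 < (e::real)"
  shows "(cmod (u + y))\<^sup>2 \<le> (1 + e) * (cmod u)\<^sup>2 + (1 + 1 / e) * (cmod y)\<^sup>2"
proof -
  have "0 \<le> (e * cmod u - cmod y)\<^sup>2 / e" using assms by simp
  also have "\<dots> = e * (cmod u)\<^sup>2 - 2 * cmod u * cmod y + (cmod y)\<^sup>2 / e"
    using assms by (simp add: field_simps power2_eq_square)
  finally have "(cmod u + cmod y)\<^sup>2 \<le> (1 + e) * (cmod u)\<^sup>2 + (1 + 1 / e) * (cmod y)\<^sup>2"
    by (simp add: algebra_simps power2_sum)
  moreover have "(cmod (u + y))\<^sup>2 \<le> (cmod u + cmod y)\<^sup>2"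
    by (intro power_mono norm_triangle_ineq) simp
  ultimately show ?thesis by linarith
qed

text \<open>Expanding the square yields the form of the Gram matrix \<open>V* diag(a) V\<close> at
  \<open>c\<close>, which is diagonal by assumption. Weight 1 serves for norms of projections, the
  eigenvalues \<open>a\<close> for the compression.\<close>

lemma weighted_norm_combination:
  fixes w :: "'j \<Rightarrow> 'i \<Rightarrow> complex"
  assumes J: "finite J"
    and gram: "\<And>j k. j \<in> J \<Longrightarrow> k \<in> J \<Longrightarrow>
      (\<Sum>i\<in>I. complex_of_real (a i) * (cnj (w j i) * w k i)) = (if j = k then complex_of_real (g j) else 0)"
  shows "(\<Sum>i\<in>I. a i * (cmod (\<Sum>j\<in>J. c j * w j i))\<^sup>2) = (\<Sum>j\<in>J. g j * (cmod (c j))\<^sup>2)"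
proof -
  have "complex_of_real (\<Sum>i\<in>I. a i * (cmod (\<Sum>j\<in>J. c j * w j i))\<^sup>2)
      = (\<Sum>i\<in>I. \<Sum>j\<in>J. \<Sum>k\<in>J. cnj (c j) * c k * (complex_of_real (a i) * (cnj (w j i) * w k i)))"
    unfolding of_real_sum of_real_mult complex_norm_square
    by (subst mult.commute[of "sum _ _" "cnj _"])
      (simp add: sum_product sum_distrib_left mult_ac)
  also have "\<dots> = (\<Sum>j\<in>J. \<Sum>k\<in>J. \<Sum>i\<in>I. cnj (c j) * c k * (complex_of_real (a i) * (cnj (w j i) * w k i)))"
    by (subst sum.swap, rule sum.cong[OF refl], rule sum.swap)
  also have "\<dots> = (\<Sum>j\<in>J. \<Sum>k\<in>J. if j = k then cnj (c j) * c k * complex_of_real (g j) else 0)"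
    unfolding sum_distrib_left[symmetric] by (intro sum.cong refl) (simp add: gram)
  also have "\<dots> = (\<Sum>j\<in>J. cnj (c j) * c j * complex_of_real (g j))"
    using J by simp
  also have "\<dots> = complex_of_real (\<Sum>j\<in>J. g j * (cmod (c j))\<^sup>2)"
    unfolding of_real_sum of_real_mult complex_norm_square by (simp add: mult_ac)
  finally show ?thesis by (simp only: of_real_eq_iff)
qed

text \<open>The subtracted vector \<open>u\<close> is the orthogonal projection
  \<open>V V* x\<close>, so \<open><u, x>\<close> and \<open><u, u>\<close> agree and two of the
  three terms of the expanded square combine.\<close>

lemma orthonormal_pythagoras:
  fixes w :: "'j \<Rightarrow> 'i \<Rightarrow> complex"
  assumes J: "finite J"
    and orth: "\<And>j k. j \<in> J \<Longrightarrow> k \<in> J \<Longrightarrow> (\<Sum>i\<in>I. cnj (w j i) * w k i) = (if j = k then 1 else 0)"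
  defines "c j x \<equiv> \<Sum>i\<in>I. cnj (w j i) * x i"
  shows "(\<Sum>i\<in>I. (cmod (x i - (\<Sum>j\<in>J. c j x * w j i)))\<^sup>2)
    = (\<Sum>i\<in>I. (cmod (x i))\<^sup>2) - (\<Sum>j\<in>J. (cmod (c j x))\<^sup>2)"
proof -
  define u where "u i = (\<Sum>j\<in>J. c j x * w j i)" for i
  have uu: "(\<Sum>i\<in>I. (cmod (u i))\<^sup>2) = (\<Sum>j\<in>J. (cmod (c j x))\<^sup>2)"
    using weighted_norm_combination[OF J, where I = I and a = "\<lambda>_. 1" and g = "\<lambda>_. 1" and w = w] orth
    by (simp add: u_def cong: if_cong)
  have "(\<Sum>i\<in>I. cnj (u i) * x i) = (\<Sum>i\<in>I. \<Sum>j\<in>J. cnj (c j x) * (cnj (w j i) * x i))"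
    by (simp add: u_def sum_distrib_right mult.assoc)
  also have "\<dots> = (\<Sum>j\<in>J. \<Sum>i\<in>I. cnj (c j x) * (cnj (w j i) * x i))"
    by (rule sum.swap)
  also have "\<dots> = (\<Sum>j\<in>J. cnj (c j x) * c j x)"
    by (simp add: c_def sum_distrib_left[symmetric])
  also have "\<dots> = complex_of_real (\<Sum>j\<in>J. (cmod (c j x))\<^sup>2)"
    unfolding of_real_sum complex_norm_square by (simp add: mult.commute)
  finally have ux: "(\<Sum>i\<in>I. Re (cnj (u i) * x i)) = (\<Sum>j\<in>J. (cmod (c j x))\<^sup>2)"
    by (metis Re_sum Re_complex_of_real)
  have "(cmod (x i - u i))\<^sup>2 = (cmod (x i))\<^sup>2 - 2 * Re (cnj (u i) * x i) + (cmod (u i))\<^sup>2" for i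
    unfolding cmod_power2 by (simp add: power2_eq_square algebra_simps)
  then have "(\<Sum>i\<in>I. (cmod (x i - u i))\<^sup>2)
      = (\<Sum>i\<in>I. (cmod (x i))\<^sup>2) - 2 * (\<Sum>i\<in>I. Re (cnj (u i) * x i)) + (\<Sum>i\<in>I. (cmod (u i))\<^sup>2)"
    by (simp only: sum.distrib sum_subtractf sum_distrib_left)
  then have "(\<Sum>i\<in>I. (cmod (x i - u i))\<^sup>2) = (\<Sum>i\<in>I. (cmod (x i))\<^sup>2) - (\<Sum>j\<in>J. (cmod (c j x))\<^sup>2)"
    unfolding uu ux by linarith
  then show ?thesis unfolding u_def .
qed

text \<open>With the isometry \<open>V\<close> whose columns are the \<open>w j\<close>, the compression \<open>V* diag(a) V = diag(s)\<close>
  makes \<open>B = (1 + e) V diag(s) V* + l (1 - V V*)\<close> dominate \<open>diag(a)\<close> once \<open>l\<close> is large, and \<open>B\<close>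
  acts on the range of \<open>V\<close> as \<open>(1 + e) diag(s)\<close>. Monotonicity and \<open>e \<rightarrow> 0\<close> give the claim.\<close>

lemma operator_jensen_lessThan:
  fixes w :: "'j \<Rightarrow> nat \<Rightarrow> complex"
  assumes f: "standard_operator_monotone f"
    and J: "finite J"
    and a: "\<And>i. i < m \<Longrightarrow> 0 < a i"
    and s: "\<And>j. j \<in> J \<Longrightarrow> 0 < s j"
    and orth: "\<And>j k. j \<in> J \<Longrightarrow> k \<in> J \<Longrightarrow> (\<Sum>i<m. cnj (w j i) * w k i) = (if j = k then 1 else 0)"
    and comp: "\<And>j k. j \<in> J \<Longrightarrow> k \<in> J \<Longrightarrow>
      (\<Sum>i<m. complex_of_real (a i) * (cnj (w j i) * w k i)) = (if j = k then complex_of_real (s j) else 0)"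
  shows "(\<Sum>i<m. f (a i) * (cmod (\<Sum>j\<in>J. c j * w j i))\<^sup>2) \<le> (\<Sum>j\<in>J. f (s j) * (cmod (c j))\<^sup>2)"
    (is "?L \<le> ?R")
proof -
  have om: "operator_monotone f"
    using f by (rule standard_operator_monotone_def[THEN iffD1, THEN conjunct1])
  have bound: "?L \<le> (1 + e) * ?R" if e: "0 < e" for e :: real
  proof -
    \<comment> \<open>The sum of the eigenvalues replaces their maximum as a bound; the factor
      \<open>1 + 1 / e\<close> is the one from Young's inequality.\<close>
    define l where "l = (1 + 1 / e) * (\<Sum>i<m. a i) + 1"
    have sum_a: "0 \<le> (\<Sum>i<m. a i)" using a by (intro sum_nonneg) (auto intro: less_imp_le)
    have a_le: "(1 + 1 / e) * a i \<le> l" if "i < m" for i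
    proof -
      have "a i \<le> (\<Sum>i<m. a i)" using a that by (intro member_le_sum) (auto intro: less_imp_le)
      then have "(1 + 1 / e) * a i \<le> (1 + 1 / e) * (\<Sum>i<m. a i)" using e by (intro mult_left_mono) auto
      then show ?thesis by (simp add: l_def)
    qed
    \<comment> \<open>Rewrites \<open>B\<close> as \<open>l 1 + V diag(r) V*\<close>, so that the
      projection onto the complement of the range need not appear.\<close>
    define r where "r j = complex_of_real ((1 + e) * s j - l)" for j
    define B where "B = mat m m (\<lambda>(i, k). (\<Sum>j\<in>J. r j * w j i * cnj (w j k))
      + (if i = k then complex_of_real l else 0))"
    have Bc: "B \<in> carrier_mat m m" by (simp add: B_def)
    have hB: "hermitian m B"
      by (rule hermitianI[OF Bc]) (auto simp: B_def r_def mult_ac intro!: sum.cong)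
    define p where "p j x = (\<Sum>k<m. cnj (w j k) * x $ k)" for j x
    have B_apply: "(B *\<^sub>v x) $ i = (\<Sum>j\<in>J. r j * w j i * p j x) + complex_of_real l * x $ i"
      if x: "x \<in> carrier_vec m" and i: "i < m" for x i
    proof -
      have "(B *\<^sub>v x) $ i = (\<Sum>k<m. (\<Sum>j\<in>J. r j * w j i * (cnj (w j k) * x $ k))
          + (if i = k then complex_of_real l * x $ k else 0))"
        using i by (subst mult_mat_vec_index[OF Bc x i], intro sum.cong)
          (auto simp: B_def sum_distrib_right distrib_right mult.assoc)
      also have "\<dots> = (\<Sum>k<m. \<Sum>j\<in>J. r j * w j i * (cnj (w j k) * x $ k)) + complex_of_real l * x $ i"
        using i by (simp add: sum.distrib)
      also have "(\<Sum>k<m. \<Sum>j\<in>J. r j * w j i * (cnj (w j k) * x $ k)) = (\<Sum>j\<in>J. r j * w j i * p j x)"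
        by (subst sum.swap) (simp add: p_def sum_distrib_left)
      finally show ?thesis .
    qed
    have qB: "qform m B x = complex_of_real ((\<Sum>j\<in>J. ((1 + e) * s j - l) * (cmod (p j x))\<^sup>2)
        + l * (\<Sum>i<m. (cmod (x $ i))\<^sup>2))" if x: "x \<in> carrier_vec m" for x
    proof -
      have cp: "cnj (p j x) = (\<Sum>i<m. w j i * cnj (x $ i))" for j by (simp add: p_def)
      have "qform m B x = (\<Sum>i<m. (\<Sum>j\<in>J. r j * p j x * (w j i * cnj (x $ i)))
          + complex_of_real l * (x $ i * cnj (x $ i)))"
        unfolding qform_eq[OF Bc x]
        by (intro sum.cong refl) (simp add: B_apply[OF x] distrib_left sum_distrib_left mult_ac
            del: index_mult_mat_vec)
      also have "\<dots> = (\<Sum>j\<in>J. \<Sum>i<m. r j * p j x * (w j i * cnj (x $ i)))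
          + complex_of_real l * (\<Sum>i<m. x $ i * cnj (x $ i))"
        by (simp add: sum.distrib sum_distrib_left) (rule sum.swap)
      also have "\<dots> = (\<Sum>j\<in>J. r j * (p j x * cnj (p j x))) + complex_of_real l * (\<Sum>i<m. x $ i * cnj (x $ i))"
        by (simp add: cp sum_distrib_left mult.assoc)
      finally show ?thesis
        by (simp add: r_def complex_norm_square[symmetric])
    qed
    let ?T = "mat_diag m (\<lambda>i. complex_of_real (a i))"
    \<comment> \<open>Split \<open>x\<close> into its projection \<open>u\<close> on the range of
      \<open>V\<close> and the rest. \<open>B\<close> has no cross terms between the two parts,
      \<open>diag(a)\<close> has; the excess \<open>e\<close> and the large \<open>l\<close> absorb
      them.\<close>
    have T_le_B: "Re (qform m ?T x) \<le> Re (qform m B x)" if x: "x \<in> carrier_vec m" for x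
    proof -
      define u where "u i = (\<Sum>j\<in>J. p j x * w j i)" for i
      have pyth: "(\<Sum>i<m. (cmod (x $ i - u i))\<^sup>2) = (\<Sum>i<m. (cmod (x $ i))\<^sup>2) - (\<Sum>j\<in>J. (cmod (p j x))\<^sup>2)"
        using orthonormal_pythagoras[OF J, where I = "{..<m}" and w = w and x = "\<lambda>i. x $ i"] orth
        by (simp add: u_def p_def)
      have "Re (qform m ?T x) = (\<Sum>i<m. a i * (cmod (u i + (x $ i - u i)))\<^sup>2)"
        by (simp add: qform_mat_diag_real[OF x])
      also have "\<dots> \<le> (\<Sum>i<m. (1 + e) * (a i * (cmod (u i))\<^sup>2) + l * (cmod (x $ i - u i))\<^sup>2)"
      proof (rule sum_mono)
        fix i assume "i \<in> {..<m}"
        then have i: "i < m" by simp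
        have "a i * (cmod (u i + (x $ i - u i)))\<^sup>2
            \<le> a i * ((1 + e) * (cmod (u i))\<^sup>2 + (1 + 1 / e) * (cmod (x $ i - u i))\<^sup>2)"
          using a[OF i] by (intro mult_left_mono cmod_add_square_le[OF e]) simp
        also have "\<dots> = (1 + e) * (a i * (cmod (u i))\<^sup>2) + (1 + 1 / e) * a i * (cmod (x $ i - u i))\<^sup>2"
          by (simp add: algebra_simps)
        also have "\<dots> \<le> (1 + e) * (a i * (cmod (u i))\<^sup>2) + l * (cmod (x $ i - u i))\<^sup>2"
          using a_le[OF i] by (intro add_left_mono mult_right_mono) simp_all
        finally show "a i * (cmod (u i + (x $ i - u i)))\<^sup>2
            \<le> (1 + e) * (a i * (cmod (u i))\<^sup>2) + l * (cmod (x $ i - u i))\<^sup>2" .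
      qed
      also have "\<dots> = (1 + e) * (\<Sum>i<m. a i * (cmod (u i))\<^sup>2) + l * (\<Sum>i<m. (cmod (x $ i - u i))\<^sup>2)"
        by (simp only: sum.distrib sum_distrib_left)
      also have "(\<Sum>i<m. a i * (cmod (u i))\<^sup>2) = (\<Sum>j\<in>J. s j * (cmod (p j x))\<^sup>2)"
        unfolding u_def by (rule weighted_norm_combination[OF J comp])
      also have "(1 + e) * (\<Sum>j\<in>J. s j * (cmod (p j x))\<^sup>2) + l * (\<Sum>i<m. (cmod (x $ i - u i))\<^sup>2)
          = Re (qform m B x)"
        unfolding pyth qB[OF x]
        by (simp add: left_diff_distrib right_diff_distrib sum_subtractf sum_distrib_left mult.assoc)
      finally show ?thesis .
    qed
    have pT: "posdef m ?T" using a by (rule posdef_mat_diag)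
    have pB: "posdef m B"
      unfolding posdef_def
    proof (intro conjI ballI impI)
      fix v :: "complex vec" assume v: "v \<in> carrier_vec m" "v \<noteq> 0\<^sub>v m"
      then show "0 < Re (qform m B v)" using pT T_le_B[OF v(1)] unfolding posdef_def by fastforce
    qed (fact hB)
    have "psd m (B - ?T)"
      unfolding psd_def
    proof (intro conjI ballI hermitian_diff hB hermitian_mat_diag_real)
      fix v :: "complex vec" assume v: "v \<in> carrier_vec m"
      show "0 \<le> Re (qform m (B - ?T) v)" using T_le_B[OF v] Bc by (simp add: qform_diff)
    qed
    then have mono: "psd m (mat_fun f B - mat_fun f ?T)"
      using om pT pB unfolding operator_monotone_def by blast
    \<comment> \<open>The test vector \<open>V c\<close>: on the range of \<open>V\<close> both
      sides of the monotonicity inequality can be computed.\<close>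
    define x where "x = vec m (\<lambda>i. \<Sum>j\<in>J. c j * w j i)"
    have x: "x \<in> carrier_vec m" by (simp add: x_def)
    note fBc = mat_fun_carrier[OF hB, of f]
    \<comment> \<open>Each column of \<open>V\<close> is an eigenvector of \<open>B\<close>, by
      orthonormality, so \<open>f(B)\<close> is known on the range of \<open>V\<close> without
      diagonalising \<open>B\<close>.\<close>
    have fBw: "mat_fun f B *\<^sub>v vec m (w k) = complex_of_real (f ((1 + e) * s k)) \<cdot>\<^sub>v vec m (w k)"
      if k: "k \<in> J" for k
    proof (rule mat_fun_eigenvector[OF hB])
      have pk: "p j (vec m (w k)) = (if j = k then 1 else 0)" if "j \<in> J" for j
        using orth[OF that k] by (simp add: p_def)
      show "B *\<^sub>v vec m (w k) = complex_of_real ((1 + e) * s k) \<cdot>\<^sub>v vec m (w k)"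
      proof (rule eq_vecI)
        fix i assume "i < dim_vec (complex_of_real ((1 + e) * s k) \<cdot>\<^sub>v vec m (w k))"
        then have i: "i < m" by simp
        have "(\<Sum>j\<in>J. r j * w j i * p j (vec m (w k))) = (\<Sum>j\<in>J. if j = k then r j * w j i else 0)"
          by (intro sum.cong refl) (simp add: pk)
        also have "\<dots> = r k * w k i" using J k by simp
        finally show "(B *\<^sub>v vec m (w k)) $ i = (complex_of_real ((1 + e) * s k) \<cdot>\<^sub>v vec m (w k)) $ i"
          using i by (simp add: B_apply r_def algebra_simps del: index_mult_mat_vec)
      qed (use Bc in simp)
    qed simp
    have fBx: "(mat_fun f B *\<^sub>v x) $ i = (\<Sum>j\<in>J. c j * (complex_of_real (f ((1 + e) * s j)) * w j i))"
      if i: "i < m" for i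
    proof -
      have "(mat_fun f B *\<^sub>v x) $ i = (\<Sum>k<m. \<Sum>j\<in>J. c j * (mat_fun f B $$ (i, k) * vec m (w j) $ k))"
        by (subst mult_mat_vec_index[OF fBc x i], intro sum.cong) (auto simp: x_def sum_distrib_left mult_ac)
      also have "\<dots> = (\<Sum>j\<in>J. c j * (\<Sum>k<m. mat_fun f B $$ (i, k) * vec m (w j) $ k))"
        by (subst sum.swap) (simp only: sum_distrib_left)
      also have "\<dots> = (\<Sum>j\<in>J. c j * (mat_fun f B *\<^sub>v vec m (w j)) $ i)"
        by (simp only: mult_mat_vec_index[OF fBc vec_carrier i])
      also have "\<dots> = (\<Sum>j\<in>J. c j * (complex_of_real (f ((1 + e) * s j)) * w j i))"
        using i by (intro sum.cong refl) (simp add: fBw del: index_mult_mat_vec)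
      finally show ?thesis .
    qed
    have qfB: "Re (qform m (mat_fun f B) x) = (\<Sum>j\<in>J. f ((1 + e) * s j) * (cmod (c j))\<^sup>2)"
    proof -
      have "qform m (mat_fun f B) x
          = (\<Sum>i<m. \<Sum>j\<in>J. (c j * complex_of_real (f ((1 + e) * s j))) * (\<Sum>k\<in>J. cnj (c k) * (cnj (w k i) * w j i)))"
        unfolding qform_eq[OF fBc x]
      proof (rule sum.cong[OF refl])
        fix i assume "i \<in> {..<m}"
        then have i: "i < m" by simp
        have "cnj (x $ i) * (mat_fun f B *\<^sub>v x) $ i
            = (\<Sum>j\<in>J. c j * (complex_of_real (f ((1 + e) * s j)) * w j i)) * (\<Sum>k\<in>J. cnj (c k) * cnj (w k i))"
          using i by (subst fBx[OF i]) (simp add: x_def mult.commute)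
        also have "\<dots> = (\<Sum>j\<in>J. (c j * complex_of_real (f ((1 + e) * s j))) *
            (\<Sum>k\<in>J. cnj (c k) * (cnj (w k i) * w j i)))"
          unfolding sum_distrib_right unfolding sum_distrib_left
          by (intro sum.cong refl) (simp only: mult_ac)
        finally show "cnj (x $ i) * (mat_fun f B *\<^sub>v x) $ i = (\<Sum>j\<in>J. (c j * complex_of_real (f ((1 + e) * s j))) *
            (\<Sum>k\<in>J. cnj (c k) * (cnj (w k i) * w j i)))" .
      qed
      also have "\<dots> = (\<Sum>j\<in>J. (c j * complex_of_real (f ((1 + e) * s j))) *
          (\<Sum>k\<in>J. cnj (c k) * (\<Sum>i<m. cnj (w k i) * w j i)))"
        by (subst sum.swap, intro sum.cong refl, subst sum_distrib_left[symmetric],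
            subst sum.swap, simp only: sum_distrib_left)
      also have "\<dots> = (\<Sum>j\<in>J. (c j * complex_of_real (f ((1 + e) * s j))) * (\<Sum>k\<in>J. if k = j then cnj (c k) else 0))"
        by (intro sum.cong refl arg_cong2[where f = "(*)"]) (simp add: orth)
      also have "\<dots> = complex_of_real (\<Sum>j\<in>J. f ((1 + e) * s j) * (cmod (c j))\<^sup>2)"
        using J unfolding of_real_sum of_real_mult complex_norm_square by (simp add: mult_ac)
      finally show ?thesis by (simp del: of_real_sum)
    qed
    have "?L = Re (qform m (mat_fun f ?T) x)"
      unfolding mat_fun_mat_diag by (simp add: qform_mat_diag_real[OF x]) (simp add: x_def)
    also have "\<dots> \<le> Re (qform m (mat_fun f B) x)"
    proof -
      have "0 \<le> Re (qform m (mat_fun f B - mat_fun f ?T) x)"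
        using mono x unfolding psd_def by blast
      then show ?thesis
        by (simp add: qform_diff fBc mat_fun_carrier[OF hermitian_mat_diag_real])
    qed
    \<comment> \<open>Pulling \<open>1 + e\<close> out of \<open>f\<close> leaves an error that is
      linear in \<open>e\<close>.\<close>
    also have "\<dots> \<le> (\<Sum>j\<in>J. (1 + e) * (f (s j) * (cmod (c j))\<^sup>2))"
      unfolding qfB mult.assoc[symmetric]
      by (intro sum_mono mult_right_mono standard_operator_monotone_scale[OF f _ e] s) simp_all
    also have "\<dots> = (1 + e) * ?R" by (simp only: sum_distrib_left)
    finally show ?thesis .
  qed
  show ?thesis
  proof (rule field_le_epsilon)
    have R0: "0 \<le> ?R"
      using f s unfolding standard_operator_monotone_def
      by (intro sum_nonneg mult_nonneg_nonneg) (auto intro: less_imp_le)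
    fix e :: real assume e: "0 < e"
    \<comment> \<open>Since \<open>?R\<close> may be 0, the error is divided by
      \<open>?R + 1\<close>; the excess is then at most \<open>e\<close>.\<close>
    have "?L \<le> (1 + e / (?R + 1)) * ?R" using bound[of "e / (?R + 1)"] e R0 by simp
    also have "\<dots> = ?R + e * (?R / (?R + 1))" by (simp add: algebra_simps)
    also have "\<dots> \<le> ?R + e * 1"
      using R0 e by (intro add_left_mono mult_left_mono) simp_all
    finally show "?L \<le> ?R + e" by simp
  qed
qed

text \<open>The Hansen--Pedersen inequality \<open>V* f(T) V \<le> f(V* T V)\<close> in eigencoordinates of \<open>T\<close> and \<open>V* T V\<close>.\<close>

lemma operator_jensen:
  fixes w :: "'j \<Rightarrow> 'i \<Rightarrow> complex"
  assumes f: "standard_operator_monotone f"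
    and I: "finite I" and J: "finite J"
    and a: "\<And>i. i \<in> I \<Longrightarrow> 0 < a i"
    and s: "\<And>j. j \<in> J \<Longrightarrow> 0 < s j"
    and orth: "\<And>j k. j \<in> J \<Longrightarrow> k \<in> J \<Longrightarrow> (\<Sum>i\<in>I. cnj (w j i) * w k i) = (if j = k then 1 else 0)"
    and comp: "\<And>j k. j \<in> J \<Longrightarrow> k \<in> J \<Longrightarrow>
      (\<Sum>i\<in>I. complex_of_real (a i) * (cnj (w j i) * w k i)) = (if j = k then complex_of_real (s j) else 0)"
  shows "(\<Sum>i\<in>I. f (a i) * (cmod (\<Sum>j\<in>J. c j * w j i))\<^sup>2) \<le> (\<Sum>j\<in>J. f (s j) * (cmod (c j))\<^sup>2)"
proof -
  \<comment> \<open>Only \<open>I\<close> has to be enumerated, since it indexes the rows of a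
    matrix; \<open>J\<close> merely labels vectors.\<close>
  obtain h where h: "bij_betw h {..<card I} I"
    using ex_bij_betw_nat_finite[OF I] by (auto simp: atLeast0LessThan)
  have reindex: "(\<Sum>i\<in>I. g i) = (\<Sum>k<card I. g (h k))" for g :: "'i \<Rightarrow> 'z::comm_monoid_add"
    by (rule sum.reindex_bij_betw[OF h, symmetric])
  have "h k \<in> I" if "k < card I" for k using h that by (auto simp: bij_betw_def)
  then show ?thesis
    unfolding reindex
    using a s orth[unfolded reindex] comp[unfolded reindex]
    by (intro operator_jensen_lessThan[OF f J, where w = "\<lambda>j k. w j (h k)"]) simp_all
qed

section \<open>Concavity of the operator mean\<close>

lemma conj_index:
  assumes "A \<in> carrier_mat n n" "U \<in> carrier_mat n n" "i < n" "j < n"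
  shows "(cadj U * A * U) $$ (i, j) = (\<Sum>k<n. \<Sum>l<n. cnj (U $$ (k, i)) * A $$ (k, l) * U $$ (l, j))"
proof -
  have "(cadj U * A * U) $$ (i, j) = (\<Sum>l<n. (\<Sum>k<n. cadj U $$ (i, k) * A $$ (k, l)) * U $$ (l, j))"
    using assms by (simp add: mult_mat_index[of _ n n _ n] del: index_mult_mat)
  also have "\<dots> = (\<Sum>l<n. \<Sum>k<n. cnj (U $$ (k, i)) * A $$ (k, l) * U $$ (l, j))"
    using assms by (simp add: sum_distrib_right cadj_index)
  finally show ?thesis by (subst (asm) sum.swap)
qed

text \<open>Joint concavity of the operator mean \<open>f (L R\<^sup>-\<^sup>1) R\<close>: writing \<open>D = (\<Sum>b. t b * E b)\<close>, the
  map \<open>V X = (t b powr (1/2) * X * D powr (-1/2) * E b powr (1/2))\<^sub>b\<close> is an isometry that compresses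
  \<open>X \<mapsto> E b * X * inverse (E b)\<close> to \<open>X \<mapsto> D * X * inverse D\<close>; its matrix in eigencoordinates is
  \<open>w\<close> below.\<close>

lemma operator_mean_concave:
  fixes t :: "'b \<Rightarrow> real"
  assumes f: "standard_operator_monotone f"
    and K: "finite K" and t: "\<And>b. b \<in> K \<Longrightarrow> 0 \<le> t b"
    and U: "unitary n U" and d: "\<And>i. i < n \<Longrightarrow> 0 < d i"
    and W: "\<And>b. b \<in> K \<Longrightarrow> unitary n (W b)" and e: "\<And>b i. b \<in> K \<Longrightarrow> i < n \<Longrightarrow> 0 < e b i"
    and D: "D = U * mat_diag n (\<lambda>i. complex_of_real (d i)) * cadj U"
    and E: "\<And>b. b \<in> K \<Longrightarrow> E b = W b * mat_diag n (\<lambda>i. complex_of_real (e b i)) * cadj (W b)"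
    and DE: "\<And>i j. i < n \<Longrightarrow> j < n \<Longrightarrow> D $$ (i, j) = (\<Sum>b\<in>K. complex_of_real (t b) * E b $$ (i, j))"
    and X: "X \<in> carrier_mat n n"
  shows "(\<Sum>b\<in>K. t b * (\<Sum>p<n. \<Sum>q<n. f (e b p / e b q) * e b q * (cmod ((cadj (W b) * X * W b) $$ (p, q)))\<^sup>2))
    \<le> (\<Sum>i<n. \<Sum>j<n. f (d i / d j) * d j * (cmod ((cadj U * X * U) $$ (i, j)))\<^sup>2)"
proof -
  \<comment> \<open>Overlap matrix of the eigenbasis of \<open>D\<close> with that of
    \<open>E b\<close>.\<close>
  define G where "G b = cadj (W b) * U" for b
  have G: "unitary n (G b)" if "b \<in> K" for b
    unfolding G_def by (intro unitary_mult unitary_cadj W U that)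
  note Uc = unitary_carrier[OF U]
  have Wc: "W b \<in> carrier_mat n n" if "b \<in> K" for b using W[OF that] by (rule unitary_carrier)
  have Gc: "G b \<in> carrier_mat n n" if "b \<in> K" for b using G[OF that] by (rule unitary_carrier)
  have Dc: "D \<in> carrier_mat n n" using Uc by (simp add: D)
  have Ec: "E b \<in> carrier_mat n n" if "b \<in> K" for b using Wc[OF that] by (simp add: E that)
  \<comment> \<open>The decomposition of \<open>D\<close> read in its own eigenbasis:
    \<open>\<Sum> t b G b* diag(e b) G b\<close> is \<open>diag(d)\<close>. Isometry and compression
    below both reduce to it.\<close>
  have spec: "(\<Sum>b\<in>K. complex_of_real (t b) * (\<Sum>p<n. complex_of_real (e b p) * (cnj (G b $$ (p, i)) * G b $$ (p, j))))
      = (if i = j then complex_of_real (d i) else 0)" if ij: "i < n" "j < n" for i j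
  proof -
    have inner: "(\<Sum>p<n. complex_of_real (e b p) * (cnj (G b $$ (p, i)) * G b $$ (p, j)))
        = (\<Sum>k<n. \<Sum>l<n. cnj (U $$ (k, i)) * E b $$ (k, l) * U $$ (l, j))" if b: "b \<in> K" for b
    proof -
      have "(\<Sum>p<n. complex_of_real (e b p) * (cnj (G b $$ (p, i)) * G b $$ (p, j)))
          = (\<Sum>k<n. \<Sum>l<n. cnj (G b $$ (k, i)) * mat_diag n (\<lambda>i. complex_of_real (e b i)) $$ (k, l) * G b $$ (l, j))"
      proof (rule sum.cong[OF refl])
        fix k assume "k \<in> {..<n}"
        then have k: "k < n" by simp
        have "(\<Sum>l<n. cnj (G b $$ (k, i)) * mat_diag n (\<lambda>i. complex_of_real (e b i)) $$ (k, l) * G b $$ (l, j))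
            = (\<Sum>l<n. if k = l then cnj (G b $$ (k, i)) * complex_of_real (e b l) * G b $$ (l, j) else 0)"
          using k by (intro sum.cong refl) (simp add: mat_diag_def)
        then show "complex_of_real (e b k) * (cnj (G b $$ (k, i)) * G b $$ (k, j)) =
            (\<Sum>l<n. cnj (G b $$ (k, i)) * mat_diag n (\<lambda>i. complex_of_real (e b i)) $$ (k, l) * G b $$ (l, j))"
          using k by (simp add: mult_ac)
      qed
      also have "\<dots> = (cadj (G b) * mat_diag n (\<lambda>i. complex_of_real (e b i)) * G b) $$ (i, j)"
        by (rule conj_index[OF mat_diag_dim Gc[OF b] ij, symmetric])
      also have "cadj (G b) * mat_diag n (\<lambda>i. complex_of_real (e b i)) * G b = cadj U * E b * U"
        using Uc Wc[OF b] by (simp add: G_def E[OF b] cadj_mult[of _ n n _ n] sq_mult_assoc[of _ n])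
      also have "\<dots> $$ (i, j) = (\<Sum>k<n. \<Sum>l<n. cnj (U $$ (k, i)) * E b $$ (k, l) * U $$ (l, j))"
        by (rule conj_index[OF Ec[OF b] Uc ij])
      finally show ?thesis .
    qed
    have "(\<Sum>b\<in>K. complex_of_real (t b) * (\<Sum>p<n. complex_of_real (e b p) * (cnj (G b $$ (p, i)) * G b $$ (p, j))))
        = (\<Sum>b\<in>K. \<Sum>k<n. \<Sum>l<n. cnj (U $$ (k, i)) * (complex_of_real (t b) * E b $$ (k, l)) * U $$ (l, j))"
      by (intro sum.cong refl, subst inner, assumption, simp add: sum_distrib_left mult_ac)
    also have "\<dots> = (\<Sum>k<n. \<Sum>l<n. \<Sum>b\<in>K. cnj (U $$ (k, i)) * (complex_of_real (t b) * E b $$ (k, l)) * U $$ (l, j))"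
      by (subst sum.swap, rule sum.cong[OF refl], rule sum.swap)
    also have "\<dots> = (\<Sum>k<n. \<Sum>l<n. cnj (U $$ (k, i)) * D $$ (k, l) * U $$ (l, j))"
      by (intro sum.cong refl) (simp add: DE sum_distrib_left sum_distrib_right)
    also have "\<dots> = (cadj U * D * U) $$ (i, j)"
      by (rule conj_index[OF Dc Uc ij, symmetric])
    also have "cadj U * D * U = mat_diag n (\<lambda>i. complex_of_real (d i))"
      using conj_unitary_eq_iff[OF U Dc, of "mat_diag n (\<lambda>i. complex_of_real (d i))"] D by simp
    finally show ?thesis using ij by (simp add: mat_diag_def)
  qed
  \<comment> \<open>Coordinates of \<open>X D^(1/2)\<close>. Under \<open>V\<close> the factor
    \<open>D^(1/2)\<close> cancels and \<open>(t b)^(1/2) X (E b)^(1/2)\<close> remains, so that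
    squared moduli produce the right factors \<open>d j\<close> and \<open>t b * e b q\<close> of
    the two perspectives.\<close>
  define c where "c = (\<lambda>(i, j). complex_of_real (sqrt (d j)) * (cadj U * X * U) $$ (i, j))"
  define w where "w = (\<lambda>(i, j) (b, p, q). complex_of_real (sqrt (t b * e b q) / sqrt (d j)) *
    (G b $$ (p, i) * cnj (G b $$ (q, j))))"
  define a where "a = (\<lambda>(b, p, q). e b p / e b q)"
  let ?I = "K \<times> {..<n} \<times> {..<n}" and ?J = "{..<n} \<times> {..<n}"
  have ww: "cnj (w (i, j) (b, p, q)) * w (i', j') (b, p, q)
      = complex_of_real (t b * e b q) / complex_of_real (sqrt (d j) * sqrt (d j')) *
        ((cnj (G b $$ (p, i)) * G b $$ (p, i')) * (cnj (G b $$ (q, j')) * G b $$ (q, j)))"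
    if "b \<in> K" "q < n" for i j i' j' b p q
  proof -
    have "sqrt (t b * e b q) * sqrt (t b * e b q) = t b * e b q"
      using t e that by (simp add: less_imp_le)
    then have "complex_of_real (sqrt (t b * e b q)) * complex_of_real (sqrt (t b * e b q))
        = complex_of_real (t b * e b q)" by (metis of_real_mult)
    then show ?thesis by (simp add: w_def field_simps)
  qed
  \<comment> \<open>The sum over \<open>p\<close> is unitarity of \<open>G b\<close>; the sum over
    \<open>q\<close> and \<open>b\<close> is \<open>spec\<close> and gives \<open>d j\<close>, which
    cancels the two square roots.\<close>
  have orth: "(\<Sum>z\<in>?I. cnj (w x z) * w y z) = (if x = y then 1 else 0)"
    if xy: "x \<in> ?J" "y \<in> ?J" for x y
  proof -
    obtain i j i' j' where x: "x = (i, j)" and y: "y = (i', j')" by (cases x, cases y)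
    have lt: "i < n" "j < n" "i' < n" "j' < n" using xy x y by auto
    let ?r = "complex_of_real (sqrt (d j) * sqrt (d j'))"
    have "(\<Sum>z\<in>?I. cnj (w x z) * w y z) = (\<Sum>b\<in>K. \<Sum>p<n. \<Sum>q<n. cnj (w x (b, p, q)) * w y (b, p, q))"
      by (simp only: sum.cartesian_product')
    also have "\<dots> = (\<Sum>b\<in>K. complex_of_real (t b) / ?r * ((\<Sum>p<n. cnj (G b $$ (p, i)) * G b $$ (p, i')) *
        (\<Sum>q<n. complex_of_real (e b q) * (cnj (G b $$ (q, j')) * G b $$ (q, j)))))"
      unfolding x y unfolding sum_distrib_right unfolding sum_distrib_left
      by (intro sum.cong refl) (simp add: ww)
    also have "\<dots> = (\<Sum>b\<in>K. (if i = i' then 1 else 0) / ?r * (complex_of_real (t b) *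
        (\<Sum>q<n. complex_of_real (e b q) * (cnj (G b $$ (q, j')) * G b $$ (q, j)))))"
      by (intro sum.cong refl) (simp add: unitary_col_sum[OF G] lt)
    also have "\<dots> = (if i = i' then 1 else 0) / ?r * (if j' = j then complex_of_real (d j') else 0)"
      unfolding sum_distrib_left[symmetric] spec[OF lt(4) lt(2)] ..
    also have "\<dots> = (if x = y then 1 else 0)"
      using d[OF lt(2)] d[OF lt(4)] by (auto simp: x y simp flip: of_real_mult)
    finally show ?thesis .
  qed
  \<comment> \<open>The weight \<open>e b p / e b q\<close> cancels \<open>e b q\<close> and brings
    in \<open>e b p\<close>, so the two sums exchange roles: now \<open>p\<close> gives
    \<open>d i\<close> by \<open>spec\<close> and \<open>q\<close> is unitarity. The square roots
    leave \<open>1 / d j\<close>.\<close>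
  have comp: "(\<Sum>z\<in>?I. complex_of_real (a z) * (cnj (w x z) * w y z))
      = (if x = y then complex_of_real (case x of (i, j) \<Rightarrow> d i / d j) else 0)"
    if xy: "x \<in> ?J" "y \<in> ?J" for x y
  proof -
    obtain i j i' j' where x: "x = (i, j)" and y: "y = (i', j')" by (cases x, cases y)
    have lt: "i < n" "j < n" "i' < n" "j' < n" using xy x y by auto
    let ?r = "complex_of_real (sqrt (d j) * sqrt (d j'))"
    have aw: "complex_of_real (a (b, p, q)) * (cnj (w x (b, p, q)) * w y (b, p, q))
        = complex_of_real (t b) / ?r * ((complex_of_real (e b p) * (cnj (G b $$ (p, i)) * G b $$ (p, i'))) *
          (cnj (G b $$ (q, j')) * G b $$ (q, j)))" if "b \<in> K" "p < n" "q < n" for b p q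
      using e[OF that(1,3)] by (simp add: x y ww that a_def)
    have "(\<Sum>z\<in>?I. complex_of_real (a z) * (cnj (w x z) * w y z))
        = (\<Sum>b\<in>K. \<Sum>p<n. \<Sum>q<n. complex_of_real (a (b, p, q)) * (cnj (w x (b, p, q)) * w y (b, p, q)))"
      by (simp only: sum.cartesian_product')
    also have "\<dots> = (\<Sum>b\<in>K. complex_of_real (t b) / ?r *
        ((\<Sum>p<n. complex_of_real (e b p) * (cnj (G b $$ (p, i)) * G b $$ (p, i'))) *
        (\<Sum>q<n. cnj (G b $$ (q, j')) * G b $$ (q, j))))"
      unfolding sum_distrib_right unfolding sum_distrib_left
      by (intro sum.cong refl) (simp only: aw lessThan_iff)
    also have "\<dots> = (\<Sum>b\<in>K. (if j' = j then 1 else 0) / ?r * (complex_of_real (t b) *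
        (\<Sum>p<n. complex_of_real (e b p) * (cnj (G b $$ (p, i)) * G b $$ (p, i')))))"
      by (intro sum.cong refl) (simp add: unitary_col_sum[OF G] lt)
    also have "\<dots> = (if j' = j then 1 else 0) / ?r * (if i = i' then complex_of_real (d i) else 0)"
      unfolding sum_distrib_left[symmetric] spec[OF lt(1) lt(3)] ..
    also have "\<dots> = (if x = y then complex_of_real (case x of (i, j) \<Rightarrow> d i / d j) else 0)"
      using d[OF lt(2)] d[OF lt(4)] by (auto simp: x y simp flip: of_real_mult)
    finally show ?thesis .
  qed
  have cw: "(\<Sum>x\<in>?J. c x * w x (b, p, q))
      = complex_of_real (sqrt (t b * e b q)) * (cadj (W b) * X * W b) $$ (p, q)"
    if b: "b \<in> K" and pq: "p < n" "q < n" for b p q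
  proof -
    define Y where "Y = cadj U * X * U"
    have Yc: "Y \<in> carrier_mat n n" using Uc X by (simp add: Y_def)
    have "(\<Sum>x\<in>?J. c x * w x (b, p, q)) = (\<Sum>i<n. \<Sum>j<n. c (i, j) * w (i, j) (b, p, q))"
      by (simp only: sum.cartesian_product')
    also have "\<dots> = (\<Sum>i<n. \<Sum>j<n. complex_of_real (sqrt (t b * e b q)) *
        (cnj (cadj (G b) $$ (i, p)) * Y $$ (i, j) * cadj (G b) $$ (j, q)))"
    proof (intro sum.cong refl)
      fix i j assume "i \<in> {..<n}" "j \<in> {..<n}"
      then show "c (i, j) * w (i, j) (b, p, q) = complex_of_real (sqrt (t b * e b q)) *
          (cnj (cadj (G b) $$ (i, p)) * Y $$ (i, j) * cadj (G b) $$ (j, q))"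
        using d[of j] pq Gc[OF b] by (simp add: c_def w_def Y_def[symmetric] cadj_index[of _ n n])
    qed
    also have "\<dots> = complex_of_real (sqrt (t b * e b q)) * (cadj (cadj (G b)) * Y * cadj (G b)) $$ (p, q)"
      by (subst conj_index[OF Yc cadj_carrier[OF Gc[OF b]] pq]) (simp only: sum_distrib_left)
    also have "cadj (cadj (G b)) * Y * cadj (G b) = cadj (W b) * X * W b"
      using Uc Wc[OF b] X unitary_cancel(2)[OF U, of _ n]
      by (simp add: G_def Y_def cadj_mult[of _ n n _ n] sq_mult_assoc[of _ n])
    finally show ?thesis .
  qed
  have "(\<Sum>z\<in>?I. f (a z) * (cmod (\<Sum>x\<in>?J. c x * w x z))\<^sup>2)
      \<le> (\<Sum>x\<in>?J. f (case x of (i, j) \<Rightarrow> d i / d j) * (cmod (c x))\<^sup>2)"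
    by (rule operator_jensen[OF f _ _ _ _ orth comp]) (use K d e in \<open>auto simp: a_def\<close>)
  moreover have "(\<Sum>z\<in>?I. f (a z) * (cmod (\<Sum>x\<in>?J. c x * w x z))\<^sup>2)
      = (\<Sum>b\<in>K. t b * (\<Sum>p<n. \<Sum>q<n. f (e b p / e b q) * e b q * (cmod ((cadj (W b) * X * W b) $$ (p, q)))\<^sup>2))"
    unfolding sum.cartesian_product'[of _ K] sum.cartesian_product'[of _ "{..<n}" "{..<n}"] sum_distrib_left
  proof (intro sum.cong refl)
    fix b p q assume "b \<in> K" "p \<in> {..<n}" "q \<in> {..<n}"
    then have bpq: "b \<in> K" "p < n" "q < n" by auto
    have *: "(cmod (\<Sum>x\<in>?J. c x * w x (b, p, q)))\<^sup>2
        = t b * e b q * (cmod ((cadj (W b) * X * W b) $$ (p, q)))\<^sup>2"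
      using t[OF bpq(1)] e[OF bpq(1,3)] unfolding cw[OF bpq] norm_mult power_mult_distrib norm_of_real
      by (simp add: less_imp_le)
    show "f (a (b, p, q)) * (cmod (\<Sum>i<n. \<Sum>j<n. c (i, j) * w (i, j) (b, p, q)))\<^sup>2
        = t b * (f (e b p / e b q) * e b q * (cmod ((cadj (W b) * X * W b) $$ (p, q)))\<^sup>2)"
      using *
      by (simp add: sum.cartesian_product' a_def)
  qed
  moreover have "(\<Sum>x\<in>?J. f (case x of (i, j) \<Rightarrow> d i / d j) * (cmod (c x))\<^sup>2)
      = (\<Sum>i<n. \<Sum>j<n. f (d i / d j) * d j * (cmod ((cadj U * X * U) $$ (i, j)))\<^sup>2)"
    unfolding sum.cartesian_product'
    using d by (intro sum.cong refl) (simp add: c_def norm_mult power_mult_distrib less_imp_le del: index_mult_mat)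
  ultimately show ?thesis by simp
qed

section \<open>The monotone metric\<close>

lemma mtrace_mult_comm:
  assumes "A \<in> carrier_mat n n" "B \<in> carrier_mat n n"
  shows "mtrace (A * B) = mtrace (B * A)"
proof -
  have "mtrace (A * B) = (\<Sum>i<n. \<Sum>k<n. A $$ (i, k) * B $$ (k, i))"
    using assms by (simp add: mtrace_def mult_mat_index[of _ n n _ n] del: index_mult_mat(1))
  also have "\<dots> = (\<Sum>k<n. \<Sum>i<n. B $$ (k, i) * A $$ (i, k))"
    by (subst sum.swap) (simp only: mult.commute)
  also have "\<dots> = mtrace (B * A)"
    using assms by (simp add: mtrace_def mult_mat_index[of _ n n _ n] del: index_mult_mat(1))
  finally show ?thesis .
qed

lemma mtrace_cadj_mult:
  assumes "A \<in> carrier_mat n n" "B \<in> carrier_mat n n"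
  shows "mtrace (cadj A * B) = (\<Sum>i<n. \<Sum>j<n. cnj (A $$ (i, j)) * B $$ (i, j))"
proof -
  have "mtrace (cadj A * B) = (\<Sum>j<n. \<Sum>i<n. cnj (A $$ (i, j)) * B $$ (i, j))"
    using assms by (simp add: mtrace_def mult_mat_index[of _ n n _ n] cadj_index[of _ n n] del: index_mult_mat(1))
  then show ?thesis by (subst sum.swap)
qed

lemma mtrace_cadj_conj_unitary:
  assumes U: "unitary n U" and A: "A \<in> carrier_mat n n" and B: "B \<in> carrier_mat n n"
  shows "mtrace (cadj (cadj U * A * U) * (cadj U * B * U)) = mtrace (cadj A * B)"
proof -
  note Uc = unitary_carrier[OF U]
  have "cadj (cadj U * A * U) * (cadj U * B * U) = cadj U * (cadj A * B * U)"
    using Uc A B unitary_cancel[OF U, of _ n] by (simp add: cadj_mult[of _ n n _ n] sq_mult_assoc[of _ n])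
  then have "mtrace (cadj (cadj U * A * U) * (cadj U * B * U)) = mtrace (cadj A * B * U * cadj U)"
    using Uc A B by (simp only: mtrace_mult_comm[of "cadj U" n] cadj_carrier sq_mult_carrier)
  also have "cadj A * B * U * cadj U = cadj A * B"
    using Uc A B unitary_right[OF U] by (simp add: sq_mult_assoc[of _ n])
  finally show ?thesis .
qed

text \<open>The choice in \<open>Jf\<close> records no sign of the eigenvalues. Testing
  \<open>D\<close> on the columns of \<open>U\<close> recovers it for any diagonalisation.\<close>

lemma posdef_spectral_pos:
  assumes D: "posdef n D" and U: "unitary n U"
    and Ud: "D = U * mat_diag n (\<lambda>i. complex_of_real (d i)) * cadj U" and i: "i < n"
  shows "0 < d i"
proof -
  note Uc = unitary_carrier[OF U]
  have Dc: "D \<in> carrier_mat n n" using D by (simp add: posdef_def hermitian_def)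
  have "cadj U * D * U = mat_diag n (\<lambda>i. complex_of_real (d i))"
    using conj_unitary_eq_iff[OF U Dc, of "mat_diag n (\<lambda>i. complex_of_real (d i))"] Ud by simp
  then have "qform n D (col U i) = complex_of_real (d i)"
    using conj_index[OF Dc Uc i i] Uc i by (simp add: qform_def mat_diag_def)
  moreover have "col U i \<noteq> 0\<^sub>v n"
  proof
    assume *: "col U i = 0\<^sub>v n"
    have "U $$ (k, i) = 0" if "k < n" for k
      using arg_cong[OF *, of "\<lambda>v. v $ k"] Uc i that by simp
    then show False using unitary_col_sum[OF U i i] by simp
  qed
  moreover have "col U i \<in> carrier_vec n" using Uc i by auto
  ultimately show ?thesis using D unfolding posdef_def by (metis Re_complex_of_real)
qed

text \<open>Exposes the diagonalisation behind the choice. It is kept from here on, and two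
  diagonalisations of the same matrix are never compared.\<close>

lemma Jf_decomp:
  assumes D: "posdef n D"
  shows "\<exists>U d. unitary n U \<and> D = U * mat_diag n (\<lambda>i. complex_of_real (d i)) * cadj U \<and>
    (\<forall>i<n. 0 < d i) \<and>
    Jf f n D = (\<lambda>X. U * Matrix.mat n n (\<lambda>(i,j).
       complex_of_real (f (d i / d j) * d j) * (cadj U * X * U) $$ (i,j)) * cadj U)"
proof -
  let ?P = "\<lambda>J. \<exists>U d. unitary n U \<and>
        D = U * mat_diag n (\<lambda>i. complex_of_real (d i)) * cadj U \<and>
        J = (\<lambda>X. U * Matrix.mat n n (\<lambda>(i,j).
               complex_of_real (f (d i / d j) * d j) * (cadj U * X * U) $$ (i,j)) * cadj U)"
  have "\<exists>J. ?P J" using hermitian_spectral[of n D] D unfolding posdef_def by blast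
  then have "?P (SOME J. ?P J)" by (rule someI_ex)
  then have "?P (Jf f n D)" by (simp only: Jf_def)
  then show ?thesis using posdef_spectral_pos[OF D] by blast
qed

text \<open>In the basis \<open>U\<close> the operator is an entrywise multiplier with positive
  entries, so its inverse is entrywise division, and the trace form does not see the change of
  basis.\<close>

lemma gamma_f_spectral:
  assumes A: "hermitian n A" and U: "unitary n U"
    and m: "\<And>i j. i < n \<Longrightarrow> j < n \<Longrightarrow> 0 < f (d i / d j) * d j"
    and J: "Jf f n D = (\<lambda>X. U * Matrix.mat n n (\<lambda>(i,j).
       complex_of_real (f (d i / d j) * d j) * (cadj U * X * U) $$ (i,j)) * cadj U)"
  shows "gamma_f f n D A A = complex_of_real
    (\<Sum>i<n. \<Sum>j<n. (cmod ((cadj U * A * U) $$ (i, j)))\<^sup>2 / (f (d i / d j) * d j))"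
proof -
  note Uc = unitary_carrier[OF U]
  have Ac: "A \<in> carrier_mat n n" and Aa: "cadj A = A" using A by (auto simp: hermitian_def)
  define A' where "A' = cadj U * A * U"
  have A'c: "A' \<in> carrier_mat n n" using Uc Ac by (simp add: A'_def)
  define Z where "Z = mat n n (\<lambda>(i, j). A' $$ (i, j) / complex_of_real (f (d i / d j) * d j))"
  have Zc: "Z \<in> carrier_mat n n" by (simp add: Z_def)
  define X where "X = U * Z * cadj U"
  have Xc: "X \<in> carrier_mat n n" using Uc Zc by (simp add: X_def)
  have XZ: "cadj U * X * U = Z" using conj_unitary_eq_iff[OF U Xc Zc] X_def by simp
  have JX: "Jf f n D X = A"
  proof -
    have "mat n n (\<lambda>(i,j). complex_of_real (f (d i / d j) * d j) * Z $$ (i, j)) = A'"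
    proof (rule eq_matI)
      fix i j assume "i < dim_row A'" "j < dim_col A'"
      then have ij: "i < n" "j < n" using A'c by auto
      then have "complex_of_real (f (d i / d j) * d j) \<noteq> 0" using m[OF ij] by (metis of_real_eq_0_iff less_irrefl)
      then show "mat n n (\<lambda>(i,j). complex_of_real (f (d i / d j) * d j) * Z $$ (i, j)) $$ (i, j) = A' $$ (i, j)"
        using ij by (simp add: Z_def del: of_real_mult)
    qed (use A'c in auto)
    then show ?thesis using conj_unitary_eq_iff[OF U Ac A'c] by (simp add: J XZ A'_def)
  qed
  \<comment> \<open>\<open>the_inv_into\<close> is a definite description and returns the preimage
    \<open>X\<close> only once injectivity on the carrier is known.\<close>
  have inj: "inj_on (Jf f n D) (carrier_mat n n)"
  proof (rule inj_onI)
    fix Y1 Y2 assume Y: "Y1 \<in> carrier_mat n n" "Y2 \<in> carrier_mat n n" and eq: "Jf f n D Y1 = Jf f n D Y2"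
    define M where "M Y = mat n n (\<lambda>(i,j). complex_of_real (f (d i / d j) * d j) * (cadj U * Y * U) $$ (i,j))" for Y
    have Mc: "M Y \<in> carrier_mat n n" for Y by (simp add: M_def)
    have JM: "Jf f n D Y = U * M Y * cadj U" for Y by (simp add: J M_def)
    have Jc: "Jf f n D Y \<in> carrier_mat n n" for Y using Uc Mc by (simp add: JM)
    have "M Y1 = cadj U * Jf f n D Y1 * U" "M Y2 = cadj U * Jf f n D Y2 * U"
      using conj_unitary_eq_iff[OF U Jc Mc] JM by metis+
    then have "M Y1 = M Y2" using eq by simp
    have "cadj U * Y1 * U = cadj U * Y2 * U"
    proof (rule eq_matI)
      fix i j assume "i < dim_row (cadj U * Y2 * U)" "j < dim_col (cadj U * Y2 * U)"
      then have ij: "i < n" "j < n" using Uc by auto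
      have "M Y1 $$ (i, j) = M Y2 $$ (i, j)" using \<open>M Y1 = M Y2\<close> by simp
      moreover have "complex_of_real (f (d i / d j) * d j) \<noteq> 0" using m[OF ij] by (metis of_real_eq_0_iff less_irrefl)
      ultimately show "(cadj U * Y1 * U) $$ (i, j) = (cadj U * Y2 * U) $$ (i, j)"
        using ij by (simp add: M_def del: of_real_mult index_mult_mat)
    qed (use Uc Y in auto)
    moreover have "cadj U * Y2 * U \<in> carrier_mat n n" using Uc Y by simp
    ultimately show "Y1 = Y2" using conj_unitary_eq_iff[OF U] Y by metis
  qed
  have "gamma_f f n D A A = mtrace (A * X)"
    unfolding gamma_f_def the_inv_into_f_eq[OF inj JX Xc] ..
  \<comment> \<open>Self-adjointness of \<open>A\<close> turns \<open>Tr A X\<close> into the inner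
    product \<open><A, X>\<close>.\<close>
  also have "\<dots> = mtrace (cadj (cadj U * A * U) * (cadj U * X * U))"
    by (simp only: mtrace_cadj_conj_unitary[OF U Ac Xc] Aa)
  also have "\<dots> = (\<Sum>i<n. \<Sum>j<n. cnj (A' $$ (i, j)) * Z $$ (i, j))"
    unfolding XZ A'_def[symmetric] by (rule mtrace_cadj_mult[OF A'c Zc])
  also have "\<dots> = complex_of_real (\<Sum>i<n. \<Sum>j<n. (cmod (A' $$ (i, j)))\<^sup>2 / (f (d i / d j) * d j))"
    unfolding of_real_sum of_real_divide complex_norm_square
    by (intro sum.cong refl) (simp add: Z_def mult.commute)
  finally show ?thesis by (simp only: A'_def)
qed

lemma posdef_convex:
  assumes "posdef n D1" "posdef n D2" "0 \<le> t" "t \<le> (1::real)"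
  shows "posdef n (complex_of_real t \<cdot>\<^sub>m D1 + complex_of_real (1 - t) \<cdot>\<^sub>m D2)" (is "posdef n ?D")
  unfolding posdef_def
proof (intro conjI ballI impI)
  have h: "hermitian n D1" "hermitian n D2" using assms by (auto simp: posdef_def)
  have c: "D1 \<in> carrier_mat n n" "D2 \<in> carrier_mat n n" using h by (auto simp: hermitian_def)
  show "hermitian n ?D"
  proof (rule hermitianI)
    fix i j assume "i < n" "j < n"
    then show "?D $$ (j, i) = cnj (?D $$ (i, j))"
      using c by (simp add: hermitian_index[OF h(1), of i j] hermitian_index[OF h(2), of i j])
  qed (use c in simp)
  fix v :: "complex vec" assume v: "v \<in> carrier_vec n" "v \<noteq> 0\<^sub>v n"
  have "qform n ?D v = complex_of_real t * qform n D1 v + complex_of_real (1 - t) * qform n D2 v"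
    using c unfolding qform_def
    by (simp add: sum_distrib_left sum.distrib[symmetric] algebra_simps)
  then have eq: "Re (qform n ?D v) = t * Re (qform n D1 v) + (1 - t) * Re (qform n D2 v)"
    by simp
  have pos: "0 < Re (qform n D1 v)" "0 < Re (qform n D2 v)" using assms v by (auto simp: posdef_def)
  show "0 < Re (qform n ?D v)"
  proof (cases "t = 0")
    case False
    then have "0 < t * Re (qform n D1 v)" using pos assms by simp
    moreover have "0 \<le> (1 - t) * Re (qform n D2 v)" using pos assms by simp
    ultimately show ?thesis unfolding eq by linarith
  qed (use pos eq in simp)
qed

text \<open>Completing the square: the easy half of the supremum formula for a single entry, with
  equality at \<open>x = a / m\<close>.\<close>

lemma quadratic_dual_le:
  assumes "0 < (m::real)"
  shows "2 * Re (cnj x * a) - m * (cmod x)\<^sup>2 \<le> (cmod a)\<^sup>2 / m"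
proof -
  have "m * (2 * Re (cnj x * a) - m * (cmod x)\<^sup>2) = (cmod a)\<^sup>2 - (cmod (a - complex_of_real m * x))\<^sup>2"
    unfolding cmod_power2 by (simp add: power2_eq_square algebra_simps)
  also have "\<dots> \<le> (cmod a)\<^sup>2" by simp
  finally show ?thesis using assms by (simp add: pos_le_divide_eq mult.commute)
qed

theorem theorem3:
  fixes f :: "real \<Rightarrow> real" and n :: nat and A :: "complex mat"
  assumes "standard_operator_monotone f"
    and "hermitian n A"
  shows "\<forall>D1 D2 (t::real). posdef n D1 \<longrightarrow> posdef n D2 \<longrightarrow> 0 \<le> t \<longrightarrow> t \<le> 1 \<longrightarrow>
           Re (gamma_f f n (complex_of_real t \<cdot>\<^sub>m D1 + complex_of_real (1 - t) \<cdot>\<^sub>m D2) A A)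
             \<le> t * Re (gamma_f f n D1 A A) + (1 - t) * Re (gamma_f f n D2 A A)"
proof (intro allI impI)
  fix D1 D2 :: "complex mat" and t :: real
  assume D1: "posdef n D1" and D2: "posdef n D2" and t: "0 \<le> t" "t \<le> 1"
  define D where "D = complex_of_real t \<cdot>\<^sub>m D1 + complex_of_real (1 - t) \<cdot>\<^sub>m D2"
  have Dc: "D1 \<in> carrier_mat n n" "D2 \<in> carrier_mat n n"
    using D1 D2 by (auto simp: posdef_def hermitian_def)
  have fpos: "0 < f x" if "0 < x" for x
    using assms(1) that unfolding standard_operator_monotone_def by blast
  have Ac: "A \<in> carrier_mat n n" using assms(2) by (simp add: hermitian_def)
  \<comment> \<open>The two endpoints become a family over \<open>bool\<close>, matching the
    weighted sum in the concavity lemma.\<close>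
  define E where "E b = (if b then D1 else D2)" for b
  define \<tau> where "\<tau> b = (if b then t else 1 - t)" for b
  have E: "posdef n (E b)" for b using D1 D2 by (simp add: E_def)
  have pD: "posdef n D" unfolding D_def by (rule posdef_convex[OF D1 D2 t])
  define P where "P D U d \<longleftrightarrow> unitary n U \<and> D = U * mat_diag n (\<lambda>i. complex_of_real (d i)) * cadj U \<and>
    (\<forall>i<n. 0 < d i) \<and>
    Jf f n D = (\<lambda>X. U * Matrix.mat n n (\<lambda>(i,j).
       complex_of_real (f (d i / d j) * d j) * (cadj U * X * U) $$ (i,j)) * cadj U)" for D U d
  have P_ex: "\<exists>U d. P D U d" if "posdef n D" for D
    unfolding P_def by (rule Jf_decomp[OF that])
  obtain U d where P: "P D U d" using P_ex[OF pD] by blast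
  then have U: "unitary n U"
    and D: "D = U * mat_diag n (\<lambda>i. complex_of_real (d i)) * cadj U"
    and d: "\<And>i. i < n \<Longrightarrow> 0 < d i"
    and J: "Jf f n D = (\<lambda>X. U * Matrix.mat n n (\<lambda>(i,j).
       complex_of_real (f (d i / d j) * d j) * (cadj U * X * U) $$ (i,j)) * cadj U)"
    unfolding P_def by blast+
  have "\<forall>b. \<exists>W e. P (E b) W e" using P_ex[OF E] by blast
  then obtain W e where PE: "\<And>b. P (E b) (W b) (e b)" by metis
  have W: "unitary n (W b)"
    and Ed: "E b = W b * mat_diag n (\<lambda>i. complex_of_real (e b i)) * cadj (W b)"
    and e: "\<And>i. i < n \<Longrightarrow> 0 < e b i"
    and JE: "Jf f n (E b) = (\<lambda>X. W b * Matrix.mat n n (\<lambda>(i,j).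
       complex_of_real (f (e b i / e b j) * e b j) * (cadj (W b) * X * W b) $$ (i,j)) * cadj (W b))" for b
    using PE[of b] unfolding P_def by blast+
  define m where "m i j = f (d i / d j) * d j" for i j
  define \<mu> where "\<mu> b i j = f (e b i / e b j) * e b j" for b i j
  have m: "0 < m i j" if "i < n" "j < n" for i j using d that fpos by (simp add: m_def)
  have \<mu>: "0 < \<mu> b i j" if "i < n" "j < n" for b i j using e that fpos by (simp add: \<mu>_def)
  define A' where "A' = cadj U * A * U"
  define B where "B b = cadj (W b) * A * W b" for b
  have gD: "Re (gamma_f f n D A A) = (\<Sum>i<n. \<Sum>j<n. (cmod (A' $$ (i, j)))\<^sup>2 / m i j)"
    using gamma_f_spectral[OF assms(2) U m[unfolded m_def] J] by (simp only: A'_def m_def Re_complex_of_real)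
  have gE: "Re (gamma_f f n (E b) A A) = (\<Sum>i<n. \<Sum>j<n. (cmod (B b $$ (i, j)))\<^sup>2 / \<mu> b i j)" for b
    using gamma_f_spectral[OF assms(2) W \<mu>[unfolded \<mu>_def] JE] by (simp only: B_def \<mu>_def Re_complex_of_real)
  note Uc = unitary_carrier[OF U] and Wc = unitary_carrier[OF W]
  have A'c: "A' \<in> carrier_mat n n" using Uc Ac by (simp add: A'_def)
  have Bc: "B b \<in> carrier_mat n n" for b using Wc Ac by (simp add: B_def)
  \<comment> \<open>The maximiser \<open>J^-1 A\<close> for the mixture \<open>D\<close>, in
    eigencoordinates. The same matrix \<open>X\<close> serves as a mere competitor at
    \<open>D1\<close> and \<open>D2\<close>.\<close>
  define Z where "Z = mat n n (\<lambda>(i, j). A' $$ (i, j) / complex_of_real (m i j))"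
  have Zc: "Z \<in> carrier_mat n n" by (simp add: Z_def)
  define X where "X = U * Z * cadj U"
  have Xc: "X \<in> carrier_mat n n" using Uc Zc by (simp add: X_def)
  have XZ: "cadj U * X * U = Z" using conj_unitary_eq_iff[OF U Xc Zc] X_def by simp
  define Y where "Y b = cadj (W b) * X * W b" for b
  have Yc: "Y b \<in> carrier_mat n n" for b using Wc Xc by (simp add: Y_def)
  \<comment> \<open>The linear term \<open>Re <X, A>\<close> does not involve the base point, so it
    has the same value in all three eigenbases.\<close>
  have ip: "(\<Sum>i<n. \<Sum>j<n. Re (cnj (Y b $$ (i, j)) * B b $$ (i, j)))
      = (\<Sum>i<n. \<Sum>j<n. Re (cnj (Z $$ (i, j)) * A' $$ (i, j)))" for b
  proof -
    have "mtrace (cadj (Y b) * B b) = mtrace (cadj Z * A')"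
      using mtrace_cadj_conj_unitary[OF W Xc Ac, of b] mtrace_cadj_conj_unitary[OF U Xc Ac]
      by (simp only: XZ A'_def Y_def B_def)
    then show ?thesis
      unfolding mtrace_cadj_mult[OF Yc Bc] mtrace_cadj_mult[OF Zc A'c]
      by (metis (no_types, lifting) Re_sum sum.cong)
  qed
  have mean: "(\<Sum>b\<in>UNIV. \<tau> b * (\<Sum>i<n. \<Sum>j<n. \<mu> b i j * (cmod (Y b $$ (i, j)))\<^sup>2))
      \<le> (\<Sum>i<n. \<Sum>j<n. m i j * (cmod (Z $$ (i, j)))\<^sup>2)"
    unfolding \<mu>_def m_def Y_def XZ[symmetric]
  proof (rule operator_mean_concave[OF assms(1) _ _ U d W e D Ed _ Xc])
    show "0 \<le> \<tau> b" for b using t by (simp add: \<tau>_def)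
    show "D $$ (i, j) = (\<Sum>b\<in>UNIV. complex_of_real (\<tau> b) * E b $$ (i, j))" if "i < n" "j < n" for i j
      using that Dc by (simp add: D_def E_def \<tau>_def UNIV_bool)
  qed simp_all
  have "Re (gamma_f f n D A A)
      = 2 * (\<Sum>i<n. \<Sum>j<n. Re (cnj (Z $$ (i, j)) * A' $$ (i, j))) - (\<Sum>i<n. \<Sum>j<n. m i j * (cmod (Z $$ (i, j)))\<^sup>2)"
    unfolding gD sum_distrib_left sum_subtractf[symmetric]
  proof (intro sum.cong refl)
    fix i j assume "i \<in> {..<n}" "j \<in> {..<n}"
    then have ij: "i < n" "j < n" by auto
    have A'Z: "A' $$ (i, j) = complex_of_real (m i j) * Z $$ (i, j)" using ij m[OF ij] by (simp add: Z_def)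
    have "Re (cnj (Z $$ (i, j)) * A' $$ (i, j)) = m i j * (cmod (Z $$ (i, j)))\<^sup>2"
      unfolding A'Z cmod_power2 by (simp add: power2_eq_square algebra_simps)
    moreover have "(cmod (A' $$ (i, j)))\<^sup>2 / m i j = m i j * (cmod (Z $$ (i, j)))\<^sup>2"
      using m[OF ij] unfolding A'Z by (simp add: norm_mult power2_eq_square)
    ultimately show "(cmod (A' $$ (i, j)))\<^sup>2 / m i j
        = 2 * Re (cnj (Z $$ (i, j)) * A' $$ (i, j)) - m i j * (cmod (Z $$ (i, j)))\<^sup>2" by simp
  qed
  also have "\<dots> \<le> 2 * (\<Sum>i<n. \<Sum>j<n. Re (cnj (Z $$ (i, j)) * A' $$ (i, j)))
      - (\<Sum>b\<in>UNIV. \<tau> b * (\<Sum>i<n. \<Sum>j<n. \<mu> b i j * (cmod (Y b $$ (i, j)))\<^sup>2))"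
    using mean by simp
  \<comment> \<open>The weights \<open>\<tau> b\<close> add up to 1, which lets the common linear
    term be distributed over the endpoints.\<close>
  also have "\<dots> = (\<Sum>b\<in>UNIV. \<tau> b * (2 * (\<Sum>i<n. \<Sum>j<n. Re (cnj (Y b $$ (i, j)) * B b $$ (i, j)))
      - (\<Sum>i<n. \<Sum>j<n. \<mu> b i j * (cmod (Y b $$ (i, j)))\<^sup>2)))"
    unfolding ip by (simp only: UNIV_bool) (simp add: \<tau>_def algebra_simps)
  also have "\<dots> \<le> (\<Sum>b\<in>UNIV. \<tau> b * Re (gamma_f f n (E b) A A))"
  proof (intro sum_mono mult_left_mono)
    fix b :: bool
    show "0 \<le> \<tau> b" using t by (simp add: \<tau>_def)
    show "2 * (\<Sum>i<n. \<Sum>j<n. Re (cnj (Y b $$ (i, j)) * B b $$ (i, j)))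
        - (\<Sum>i<n. \<Sum>j<n. \<mu> b i j * (cmod (Y b $$ (i, j)))\<^sup>2) \<le> Re (gamma_f f n (E b) A A)"
      unfolding gE sum_distrib_left sum_subtractf[symmetric]
      by (intro sum_mono quadratic_dual_le \<mu>) simp_all
  qed
  also have "\<dots> = t * Re (gamma_f f n D1 A A) + (1 - t) * Re (gamma_f f n D2 A A)"
    by (simp add: UNIV_bool \<tau>_def E_def)
  finally show "Re (gamma_f f n (complex_of_real t \<cdot>\<^sub>m D1 + complex_of_real (1 - t) \<cdot>\<^sub>m D2) A A)
      \<le> t * Re (gamma_f f n D1 A A) + (1 - t) * Re (gamma_f f n D2 A A)"
    unfolding D_def .
qed

end
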